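(* Fix a positive integer $k$ and let $u,v\in A^*$ be distinct words of length $2k$. Then $u\sim_k v$ if and only if there exist distinct letters $a,b\in A$, a Sturmian word $\omega\in\{a,b\}^{\mathbb N}$ and a right special factor $x$ of $\omega$ of length $k-1$ (empty when $k=1$) such that \[u=xab\bar x\quad\text{and}\quad v=xba\bar x.\] In particular, $u$ and $v$ are both factors of the same Sturmian word $\omega$.
   Context: $|u|_x$ is the number of occurrences of the non-empty word $x$ as a factor of $u$; $u\sim_k v$ means $|u|_x=|v|_x$ for all non-empty $x$ with $|x|\le k$. $\bar x$ denotes the reversal of $x$. A Sturmian word is an infinite word over a two-letter alphabet with exactly $n+1$ factors of length $n$ for every $n\ge0$. A factor $x$ of an infinite word $\omega$ is right special if there exist distinct letters $c,d$ with both $xc$ and $xd$ factors of $\omega$. *)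

theory Defs
  imports Main "HOL-Library.Omega_Words_Fun"
begin

text \<open>
  An alphabet is a type, and an infinite word is a function on \<^typ>\<open>nat\<close>
  (the type \<open>'a word\<close> of the imported library).
\<close>

definition occ_count :: "'a list \<Rightarrow> 'a list \<Rightarrow> nat" where
  "occ_count u x = card {i. i + length x \<le> length u \<and> take (length x) (drop i u) = x}"

definition k_abelian_equiv :: "nat \<Rightarrow> 'a list \<Rightarrow> 'a list \<Rightarrow> bool" where
  "k_abelian_equiv k u v \<longleftrightarrow>
     (\<forall>x. x \<noteq> [] \<longrightarrow> length x \<le> k \<longrightarrow> occ_count u x = occ_count v x)"

definition factors :: "'a word \<Rightarrow> 'a list set" where
  "factors w = {w [i \<rightarrow> j] | i j. i \<le> j}"

definition sturmian :: "'a set \<Rightarrow> 'a word \<Rightarrow> bool" where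
  "sturmian B w \<longleftrightarrow> card B = 2 \<and> range w \<subseteq> B \<and>
     (\<forall>n. card {x \<in> factors w. length x = n} = n + 1)"

definition right_special :: "'a word \<Rightarrow> 'a list \<Rightarrow> bool" where
  "right_special w x \<longleftrightarrow> x \<in> factors w \<and>
     (\<exists>c d. c \<noteq> d \<and> x @ [c] \<in> factors w \<and> x @ [d] \<in> factors w)"

end

theory Submission
  imports Defs "HOL-Analysis.Kronecker_Approximation_Theorem" "HOL-Analysis.Continuum_Not_Denumerable"
begin

text \<open>
  Both directions go through slopes. A Sturmian word over \<open>{a, b}\<close> is balanced, so its number of
  letters \<open>b\<close> in a prefix of length \<open>n\<close> is \<open>n\<alpha> + \<rho>\<close> up to rounding, for an irrational \<open>\<alpha>\<close>. A right
  special factor \<open>x\<close> is then the reversal of the prefix of the characteristic word of slope \<open>\<alpha>\<close>, and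
  \<open>xba\<bar>x\<close>, \<open>xab\<bar>x\<close> code a rotation orbit passing through \<open>0\<close> from the right and from the left; they
  are factors by Kronecker's theorem. In either word the \<open>n + 1\<close> windows of length \<open>n\<close> that are
  not inside \<open>x\<close> or \<open>\<bar>x\<close> are distinct, hence they are all the factors of length \<open>n\<close>, once each.

  Conversely, counting prefixes and suffixes gives \<open>u = xaby\<close>, \<open>v = xbay\<close>, where the windows of length
  \<open>k\<close> of \<open>u\<close> and \<open>v\<close> form the same set. Passing from the window of \<open>u\<close> to the window of \<open>v\<close> at the same
  place turns one \<open>ab\<close> into \<open>ba\<close> (or a final \<open>a\<close> into \<open>b\<close>), except for the last window, where \<open>by\<close>
  becomes \<open>ay\<close>. Hence these steps lead from \<open>ay\<close> to \<open>by\<close> through all windows, moving letters \<open>b\<close> only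
  to the left, so every prefix of every window contains as many \<open>b\<close> as the prefix of \<open>ay\<close> of that
  length, or one more. This makes the heights of \<open>y\<close> quasi-additive, equal to those of the
  reversal of \<open>x\<close>, and realised by an irrational slope.
\<close>

section \<open>Blocks and balance of Sturmian words\<close>

definition block :: "'a word \<Rightarrow> nat \<Rightarrow> nat \<Rightarrow> 'a list" where
  "block w i n = w [i \<rightarrow> i + n]"

lemma length_block [simp]: "length (block w i n) = n"
  by (simp add: block_def)

lemma nth_block [simp]: "m < n \<Longrightarrow> block w i n ! m = w (i + m)"
  by (simp add: block_def)

lemma block_eq_iff: "block w i n = block v j n \<longleftrightarrow> (\<forall>m<n. w (i + m) = v (j + m))"
  by (auto simp: list_eq_iff_nth_eq)

lemma block_Suc: "block w i (Suc n) = block w i n @ [w (i + n)]"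
  by (simp add: block_def subsequence_def)

lemma block_Cons: "block w i (Suc n) = w i # block w (Suc i) n"
  by (simp add: block_def subsequence_def upt_conv_Cons del: upt_Suc)

lemma block_in_factors: "block w i n \<in> factors w"
  unfolding factors_def block_def by force

lemma factors_iff_block: "x \<in> factors w \<longleftrightarrow> (\<exists>i. x = block w i (length x))"
proof
  assume "x \<in> factors w"
  then obtain i j where "i \<le> j" "x = w [i \<rightarrow> j]"
    unfolding factors_def by blast
  then show "\<exists>i. x = block w i (length x)"
    by (intro exI[of _ i]) (simp add: block_def)
next
  assume "\<exists>i. x = block w i (length x)"
  then show "x \<in> factors w"
    using block_in_factors by metis
qed

lemma factors_of_length: "{x \<in> factors w. length x = n} = range (\<lambda>i. block w i n)"
  using block_in_factors[of w] by (auto simp: factors_iff_block)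

lemma sturmian_card_blocks:
  assumes "sturmian B w" shows "card (range (\<lambda>i. block w i n)) = n + 1"
  using assms unfolding sturmian_def factors_of_length by blast

lemma sturmian_finite_blocks:
  assumes "sturmian B w" shows "finite (range (\<lambda>i. block w i n))"
  using sturmian_card_blocks[OF assms, of n] by (simp add: card_ge_0_finite)

text \<open>With preperiod \<open>N\<close> and period \<open>q\<close>, every block already starts
  before position \<open>N + q\<close>. So there are at most \<open>N + q\<close> blocks of each
  length, too few for length \<open>N + q\<close>.\<close>

lemma sturmian_not_eventually_periodic:
  assumes st: "sturmian B w" and "q > 0" and per: "\<And>m. m \<ge> N \<Longrightarrow> w (m + q) = w m"
  shows False
proof -
  define n where "n = N + q"
  have "block w i n \<in> (\<lambda>i. block w i n) ` {..<N+q}" for i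
  proof (induction i rule: less_induct)
    case (less i)
    show ?case
    proof (cases "i < N + q")
      case False
      then have "block w i n = block w (i - q) n"
        unfolding block_eq_iff using per[of "i - q + m" for m] by (auto simp: algebra_simps)
      then show ?thesis using less.IH[of "i - q"] False \<open>q > 0\<close> by auto
    qed auto
  qed
  then have "range (\<lambda>i. block w i n) \<subseteq> (\<lambda>i. block w i n) ` {..<N+q}" by blast
  then have "card (range (\<lambda>i. block w i n)) \<le> card ((\<lambda>i. block w i n) ` {..<N+q})"
    by (intro card_mono) auto
  also have "\<dots> \<le> N + q" using card_image_le[of "{..<N+q}"] by simp
  finally show False using sturmian_card_blocks[OF st, of n] unfolding n_def by simp
qed

text \<open>Every block of length \<open>n\<close> has at least one extension to the right;
  \<open>e\<close> picks one. Two different right special blocks would each add a further extension,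
  giving \<open>n + 3\<close> blocks of length \<open>n + 1\<close>.\<close>

lemma sturmian_right_special_unique:
  assumes st: "sturmian B w"
    and p: "block w p1 n = block w p2 n" "w (p1 + n) \<noteq> w (p2 + n)"
    and q: "block w q1 n = block w q2 n" "w (q1 + n) \<noteq> w (q2 + n)"
  shows "block w p1 n = block w q1 n"
proof (rule ccontr)
  assume ne: "block w p1 n \<noteq> block w q1 n"
  define S where "S = range (\<lambda>i. block w i n)"
  define T where "T = range (\<lambda>i. block w i (Suc n))"
  define e where "e z = (SOME t. t \<in> T \<and> butlast t = z)" for z
  have e: "e z \<in> T \<and> butlast (e z) = z" if z: "z \<in> S" for z
  proof -
    from z obtain i where "z = block w i n" unfolding S_def by blast
    then have "block w i (Suc n) \<in> T \<and> butlast (block w i (Suc n)) = z"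
      unfolding T_def by (simp add: block_Suc)
    then show ?thesis unfolding e_def by (rule someI)
  qed
  have other: "\<exists>t\<in>T. butlast t = block w i n \<and> t \<noteq> e (block w i n)"
    if "block w i n = block w j n" "w (i + n) \<noteq> w (j + n)" for i j
  proof -
    have "block w i (Suc n) \<noteq> block w j (Suc n)" "butlast (block w i (Suc n)) = block w i n"
         "butlast (block w j (Suc n)) = block w i n"
      using that by (simp_all add: block_Suc)
    then show ?thesis unfolding T_def by (metis rangeI)
  qed
  obtain s where s: "s \<in> T" "butlast s = block w p1 n" "s \<noteq> e (block w p1 n)"
    using other[OF p] by blast
  obtain t where t: "t \<in> T" "butlast t = block w q1 n" "t \<noteq> e (block w q1 n)"
    using other[OF q] by blast
  have inj: "inj_on e S" by (metis e inj_onI)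
  have "s \<notin> e ` S" "t \<notin> e ` S" "s \<noteq> t" using e s t ne by auto
  moreover have "finite S" unfolding S_def using sturmian_finite_blocks[OF st] .
  ultimately have "card (insert s (insert t (e ` S))) = card S + 2"
    by (simp add: card_image[OF inj])
  moreover have "insert s (insert t (e ` S)) \<subseteq> T" using e s t by auto
  moreover have "finite T" unfolding T_def using sturmian_finite_blocks[OF st] .
  ultimately have "card S + 2 \<le> card T" by (metis card_mono)
  then show False
    unfolding S_def T_def using sturmian_card_blocks[OF st, of n] sturmian_card_blocks[OF st, of "Suc n"] by simp
qed

text \<open>
  The core of the balance property (Morse and Hedlund): for the palindrome \<open>W\<close> at
  positions \<open>i + 1, \<dots>, i + n\<close>, if \<open>bWb\<close> and \<open>aWa\<close> are factors and \<open>bW\<close> is not right special,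
  then \<open>aW\<close> is the only right special word of its length and is not met on
  the \<open>n + 2\<close> positions from \<open>i\<close> on, which forces a deterministic loop.
\<close>

lemma sturmian_no_palindrome_pair_aux:
  assumes st: "sturmian B w"
    and i: "w i = b" "w (i + Suc n) = b" and j: "w j = a" "w (j + Suc n) = a" and ab: "a \<noteq> b"
    and eq: "\<And>m. m < n \<Longrightarrow> w (Suc i + m) = w (Suc j + m)"
    and pal: "\<And>m. m < n \<Longrightarrow> w (Suc i + m) = w (Suc i + (n - 1 - m))"
    and nrs: "\<And>p. block w p (Suc n) = block w i (Suc n) \<Longrightarrow> w (p + Suc n) = b"
  shows False
proof -
  define X where "X = block w j (Suc n)"
  \<comment> \<open>Without its first letter, a right special block of length \<open>n + 1\<close>
    is right special of length \<open>n\<close>, hence equal to \<open>W\<close>. Its first letter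
    is not \<open>b\<close> by \<open>nrs\<close>, so the block is \<open>X\<close>, which is
    \<open>aW\<close>.\<close>
  have rs: "block w p (Suc n) = X"
    if "block w p (Suc n) = block w p' (Suc n)" "w (p + Suc n) \<noteq> w (p' + Suc n)" for p p'
  proof -
    have "block w (Suc p) n = block w (Suc i) n"
    proof (rule sturmian_right_special_unique[OF st])
      show "block w (Suc p) n = block w (Suc p') n" using that(1) by (simp add: block_Cons)
      show "w (Suc p + n) \<noteq> w (Suc p' + n)" using that(2) by simp
      show "block w (Suc i) n = block w (Suc j) n" using eq unfolding block_eq_iff by blast
      show "w (Suc i + n) \<noteq> w (Suc j + n)" using i j ab by simp
    qed
    moreover have "w p \<noteq> b"
    proof
      assume "w p = b"
      then have "block w p (Suc n) = block w i (Suc n)"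
        using calculation i by (simp add: block_Cons)
      then show False using nrs that by metis
    qed
    moreover have "w p \<in> B" "B = {a, b}"
    proof -
      show "w p \<in> B" using st unfolding sturmian_def by auto
      have "card B = 2" "a \<in> B" "b \<in> B" using st i j unfolding sturmian_def by auto
      then show "B = {a, b}" using ab
        by (metis card_2_iff insert_iff singletonD doubleton_eq_iff)
    qed
    ultimately have "w p = w j" "block w (Suc p) n = block w (Suc j) n"
      using j eq by (auto simp: block_eq_iff)
    then show ?thesis unfolding X_def by (simp add: block_Cons)
  qed
  \<comment> \<open>If \<open>aW\<close> occurred at \<open>i + d\<close>, letter
    \<open>d - 1\<close> of \<open>W\<close> would be \<open>a\<close>, and letter
    \<open>n - d\<close> of \<open>W\<close> would be the \<open>b\<close> at
    \<open>i + n + 1\<close>. These two positions mirror each other in the palindrome.\<close>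
  have avoid: "block w (i + d) (Suc n) \<noteq> X" if "d \<le> Suc n" for d
  proof
    assume *: "block w (i + d) (Suc n) = X"
    have tails: "block w (Suc (i + d)) n = block w (Suc j) n" and first: "w (i + d) = a"
      using * j unfolding X_def block_Cons by auto
    have rest: "w (Suc (i + d) + m) = w (Suc i + m)" if "m < n" for m
      using tails eq[OF that] that unfolding block_eq_iff by metis
    have "d \<noteq> 0" "d \<noteq> Suc n" using first i ab by (auto intro: ccontr)
    then have d: "0 < d" "d \<le> n" using that by auto
    have "w (Suc i + (d - 1)) = a" using first d by simp
    moreover have "w (Suc i + (n - d)) = b"
      using rest[of "n - d"] d i by (simp add: algebra_simps)
    moreover have "w (Suc i + (d - 1)) = w (Suc i + (n - d))"
      using pal[of "d - 1"] d by (simp add: algebra_simps)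
    ultimately show False using ab by simp
  qed
  define f where "f d = block w (i + d) (Suc n)" for d
  define S where "S = range (\<lambda>i. block w i (Suc n))"
  have fin: "finite S" unfolding S_def using sturmian_finite_blocks[OF st] .
  \<comment> \<open>Pigeonhole: \<open>n + 2\<close> starting positions, but only
    \<open>n + 1\<close> blocks other than \<open>X\<close>.\<close>
  have "\<not> inj_on f {..Suc n}"
  proof
    assume inj: "inj_on f {..Suc n}"
    have "f ` {..Suc n} \<subseteq> S - {X}" unfolding f_def S_def using avoid by auto
    then have "card (f ` {..Suc n}) \<le> card (S - {X})" using fin by (intro card_mono) auto
    moreover have "X \<in> S" unfolding S_def X_def by blast
    ultimately show False
      using card_image[OF inj] sturmian_card_blocks[OF st, of "Suc n"] fin
      by (simp add: S_def)
  qed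
  then obtain c d where cd: "c < d" "d \<le> Suc n" "f c = f d"
    unfolding inj_on_def by (metis atMost_iff linorder_neqE_nat)
  define p Q where "p = i + c" and "Q = d - c"
  \<comment> \<open>A block other than \<open>X\<close> determines the next letter, so the
    repetition at distance \<open>Q\<close> propagates for ever, and \<open>X\<close> stays
    excluded.\<close>
  have loop: "block w (p + t) (Suc n) \<noteq> X \<and> block w (p + t + Q) (Suc n) = block w (p + t) (Suc n)" for t
  proof (induction t rule: less_induct)
    case (less t)
    have 1: "block w (p + t) (Suc n) \<noteq> X"
    proof (cases "t < Q")
      case True then show ?thesis using avoid[of "c + t"] cd by (simp add: p_def Q_def add.assoc)
    next
      case False
      then show ?thesis using less.IH[of "t - Q"] cd by (auto simp: Q_def)
    qed
    have 2: "block w (p + t + Q) (Suc n) = block w (p + t) (Suc n)"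
    proof (cases t)
      case 0 then show ?thesis using cd by (simp add: f_def p_def Q_def)
    next
      case (Suc s)
      have s: "block w (p + s + Q) (Suc n) = block w (p + s) (Suc n)" "block w (p + s) (Suc n) \<noteq> X"
        using less.IH[of s] Suc by auto
      have "w (p + s + Q + Suc n) = w (p + s + Suc n)" using rs[of "p + s" "p + s + Q"] s by metis
      then have "block w (p + s + Q) (Suc (Suc n)) = block w (p + s) (Suc (Suc n))"
        using s by (metis block_Suc)
      then show ?thesis unfolding Suc by (simp add: block_Cons)
    qed
    show ?case using 1 2 by blast
  qed
  show False
  proof (rule sturmian_not_eventually_periodic[OF st])
    show "0 < Q" using cd by (simp add: Q_def)
    show "w (m + Q) = w m" if "p \<le> m" for m
      using loop[of "m - p"] that by (simp add: block_Cons)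
  qed
qed

text \<open>At most one of \<open>bW\<close> and \<open>aW\<close> is right special. The previous
  lemma applies to the other one, if necessary with the two letters exchanged.\<close>

lemma sturmian_no_palindrome_pair:
  assumes st: "sturmian B w"
    and i: "w i = b" "w (i + Suc n) = b" and j: "w j = a" "w (j + Suc n) = a" and ab: "a \<noteq> b"
    and eq: "\<And>m. m < n \<Longrightarrow> w (Suc i + m) = w (Suc j + m)"
    and pal: "\<And>m. m < n \<Longrightarrow> w (Suc i + m) = w (Suc i + (n - 1 - m))"
  shows False
proof (cases "\<forall>p. block w p (Suc n) = block w i (Suc n) \<longrightarrow> w (p + Suc n) = b")
  case True
  then show False using sturmian_no_palindrome_pair_aux[OF st i j ab eq pal] by blast
next
  case False
  then obtain p where p: "block w i (Suc n) = block w p (Suc n)" "w (i + Suc n) \<noteq> w (p + Suc n)"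
    using i by metis
  have "w (q + Suc n) = a" if "block w q (Suc n) = block w j (Suc n)" for q
  proof (rule ccontr)
    assume "w (q + Suc n) \<noteq> a"
    then have "block w i (Suc n) = block w q (Suc n)"
      using that j by (intro sturmian_right_special_unique[OF st p, of q j]) auto
    then show False using that i j ab by (simp add: block_Cons)
  qed
  moreover have "w (Suc j + m) = w (Suc j + (n - 1 - m))" if "m < n" for m
    using eq[of m] eq[of "n - 1 - m"] pal[of m] that by simp
  ultimately show False
    using sturmian_no_palindrome_pair_aux[OF st j i] ab eq by metis
qed

definition height :: "'a \<Rightarrow> 'a word \<Rightarrow> nat \<Rightarrow> int" where
  "height b w n = (\<Sum>i<n. (if w i = b then 1 else 0))"

lemma height_0 [simp]: "height b w 0 = 0"
  by (simp add: height_def)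

lemma height_Suc [simp]: "height b w (Suc n) = height b w n + (if w n = b then 1 else 0)"
  by (simp add: height_def)

lemma sturmian_two_letters:
  assumes "sturmian {a, b} w" shows "a \<noteq> b" "w i = a \<or> w i = b"
  using assms unfolding sturmian_def by auto

text \<open>Two blocks of minimal length whose numbers of \<open>b\<close> differ by at least 2 must
  have the form \<open>bWb\<close> and \<open>aWa\<close> with \<open>W\<close> a palindrome, which
  is impossible.\<close>

lemma sturmian_balanced:
  assumes st: "sturmian {a, b} w"
  shows "height b w (i + n) - height b w i \<le> height b w (j + n) - height b w j + 1"
proof (rule ccontr)
  define D where "D i n = height b w (i + n) - height b w i" for i n
  have D_Suc: "D i (Suc m) = D i m + (if w (i + m) = b then 1 else 0)" for i m
    by (simp add: D_def)
  have D_0 [simp]: "D i 0 = 0" for i by (simp add: D_def)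
  have D_add: "D i (m + m') = D i m + D (i + m) m'" for i m m'
    by (simp add: D_def add.assoc)
  assume "\<not> ?thesis"
  then have "\<exists>n i j. D i n \<ge> D j n + 2"
    by (intro exI[of _ n] exI[of _ i] exI[of _ j]) (simp add: D_def)
  then obtain n where "\<exists>i j. D i n \<ge> D j n + 2"
    and min: "\<And>m. m < n \<Longrightarrow> \<not> (\<exists>i j. D i m \<ge> D j m + 2)"
    using exists_least_iff[of "\<lambda>n. \<exists>i j. D i n \<ge> D j n + 2"] by blast
  then obtain i j where ij: "D i n \<ge> D j n + 2" by blast
  have bal: "D i' m \<le> D j' m + 1" if "m < n" for i' j' m
    using min[OF that] by (metis add.assoc int_one_le_iff_zero_less linorder_not_less one_add_one zless_imp_add1_zle)
  \<comment> \<open>At most 1 by minimality of \<open>n\<close>; at least 1 because the remaining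
    \<open>n - m\<close> letters also contribute at most 1 to the difference.\<close>
  have E: "D i m = D j m + 1" if "0 < m" "m < n" for m
  proof -
    have "D (i + m) (n - m) \<le> D (j + m) (n - m) + 1" using that by (intro bal) auto
    then have "D i m \<ge> D j m + 1" using ij D_add[of i m "n - m"] D_add[of j m "n - m"] that by simp
    then show ?thesis using bal[OF that(2), of i j] by simp
  qed
  have "n \<noteq> 0" using ij by (auto intro: ccontr)
  moreover have "n \<noteq> 1" using ij D_Suc[of i 0] D_Suc[of j 0] by (auto split: if_splits)
  ultimately obtain N where N: "n = Suc (Suc N)" by (metis One_nat_def not0_implies_Suc)
  have step: "w (i + m) = b \<longleftrightarrow> w (j + m) = b" if "0 < m" "m < Suc N" for m
    using E[of m] E[of "Suc m"] that N by (auto simp: D_Suc split: if_splits)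
  have first: "w i = b" "w j \<noteq> b"
    using E[of "Suc 0"] N by (auto simp: D_Suc split: if_splits)
  have "D i (Suc N) = D j (Suc N) + 1" using E[of "Suc N"] N by simp
  then have last: "w (i + Suc N) = b" "w (j + Suc N) \<noteq> b"
    using ij unfolding N D_Suc[of _ "Suc N"] by (auto split: if_splits)
  \<comment> \<open>The prefix and the suffix of length \<open>m\<close> at \<open>i\<close> both
    have one \<open>b\<close> more than those at \<open>j\<close>. Balance for length
    \<open>m\<close> across the two blocks then gives both inequalities.\<close>
  have mirror: "D i m = D (i + n - m) m" if m: "0 < m" "m < n" for m
  proof -
    have n: "D i n = D j n + 2"
      using \<open>D i (Suc N) = D j (Suc N) + 1\<close> last unfolding N D_Suc[of _ "Suc N"] by simp
    have "D (i + n - m) m = D (j + n - m) m + 1"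
      using n E[of "n - m"] m D_add[of i "n - m" m] D_add[of j "n - m" m] by simp
    moreover have "D i m = D j m + 1" using E m by simp
    moreover have "D i m \<le> D (j + n - m) m + 1" "D (i + n - m) m \<le> D j m + 1"
      using bal m by auto
    ultimately show ?thesis by simp
  qed
  have pal: "w (Suc i + m) = w (Suc i + (N - 1 - m))" if "m < N" for m
  proof -
    have "i + n - Suc (Suc m) = i + (N - m)" "i + n - Suc m = Suc (i + (N - m))"
      using that N by auto
    then have "w (Suc i + m) = b \<longleftrightarrow> w (i + (N - m)) = b"
      using mirror[of "Suc m"] mirror[of "Suc (Suc m)"] that N
      by (auto simp: D_def split: if_splits)
    then show ?thesis using sturmian_two_letters[OF st] that
      by (metis Suc_diff_Suc add_Suc_shift diff_Suc_1 diff_diff_left diff_Suc_eq_diff_pred plus_1_eq_Suc)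
  qed
  show False
  proof (rule sturmian_no_palindrome_pair[OF st])
    show "w i = b" "w (i + Suc N) = b" using first last by auto
    show "w j = a" "w (j + Suc N) = a" using first last sturmian_two_letters(2)[OF st] by blast+
    show "a \<noteq> b" using sturmian_two_letters(1)[OF st] .
    show "w (Suc i + m) = w (Suc j + m)" if "m < N" for m
      using step[of "Suc m"] that sturmian_two_letters(2)[OF st] by (metis Suc_mono add_Suc_right add_Suc zero_less_Suc)
    show "w (Suc i + m) = w (Suc i + (N - 1 - m))" if "m < N" for m
      using pal that by blast
  qed
qed

section \<open>The slope of a Sturmian word\<close>

text \<open>Both inequalities are weak: where \<open>n\<alpha> + \<rho>\<close> is an integer,
  either rounding is allowed, so lower and upper mechanical words are covered alike.\<close>

definition slope_coding :: "real \<Rightarrow> real \<Rightarrow> 'a \<Rightarrow> 'a word \<Rightarrow> bool" where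
  "slope_coding \<alpha> \<rho> b w \<longleftrightarrow>
     (\<forall>n. real_of_int (height b w n) \<le> real n * \<alpha> + \<rho> \<and>
         real n * \<alpha> + \<rho> \<le> real_of_int (height b w n) + 1)"

text \<open>By balance, blocks of length \<open>n\<close> contain \<open>l n\<close> or
  \<open>l n + 1\<close> letters \<open>b\<close>. The slope is the supremum of
  \<open>l n / n\<close>, the intercept that of the deviations \<open>e n\<close>. The two-value
  property is passed on for the proof of irrationality.\<close>

lemma sturmian_slope_coding_aux:
  assumes st: "sturmian {a, b} w"
  obtains \<alpha> \<rho> where "0 \<le> \<alpha>" "\<alpha> \<le> 1" "slope_coding \<alpha> \<rho> b w"
    "\<And>n. \<exists>l. \<forall>m. height b w (m + n) - height b w m \<in> {l, l + 1}"
proof -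
  define D where "D i n = height b w (i + n) - height b w i" for i n
  have "\<exists>l. \<forall>m. D m n \<in> {l, l + 1}" for n
  proof (cases "\<exists>m. D m n < D 0 n")
    case True
    then obtain m where m: "D m n < D 0 n" by blast
    have "D m' n \<in> {D m n, D m n + 1}" for m'
      using sturmian_balanced[OF st, of m' n m] sturmian_balanced[OF st, of 0 n m']
        m unfolding D_def by auto
    then show ?thesis by blast
  next
    case False
    have "D m' n \<in> {D 0 n, D 0 n + 1}" for m'
      using sturmian_balanced[OF st, of m' n 0] False unfolding D_def
      by (smt (verit) insert_iff)
    then show ?thesis by blast
  qed
  then obtain l where l: "\<And>n m. D m n \<in> {l n, l n + 1}" by metis
  have l': "l n \<le> D m n" "D m n \<le> l n + 1" for n m
    using l[of m n] by auto
  have lower: "D m (j * i) \<ge> j * l i" for i j m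
  proof (induction j arbitrary: m)
    case (Suc j)
    have "D m (Suc j * i) = D m i + D (m + i) (j * i)" by (simp add: D_def add_ac)
    then show ?case using Suc[of "m + i"] l'(1)[of i m] by (simp add: algebra_simps)
  qed (simp add: D_def)
  have upper: "D m (j * i) \<le> j * (l i + 1)" for i j m
  proof (induction j arbitrary: m)
    case (Suc j)
    have "D m (Suc j * i) = D m i + D (m + i) (j * i)" by (simp add: D_def add_ac)
    then show ?case using Suc[of "m + i"] l'(2)[of m i] by (simp add: algebra_simps)
  qed (simp add: D_def)
  \<comment> \<open>The prefix of length \<open>i * j\<close> is cut once into \<open>j\<close>
    blocks of length \<open>i\<close> and once into \<open>i\<close> blocks of length
    \<open>j\<close>.\<close>
  have cross: "j * l i \<le> i * (l j + 1)" for i j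
    using lower[where m=0 and i=i and j=j] upper[where m=0 and i=j and j=i] by (simp add: mult.commute)
  have cross': "real_of_int (l i) / real i \<le> (real_of_int (l j) + 1) / real j" if "0 < i" "0 < j" for i j
  proof -
    have "real_of_int (j * l i) \<le> real_of_int (i * (l j + 1))" using cross by (metis of_int_le_iff)
    then show ?thesis using that by (simp add: field_simps)
  qed
  define \<alpha> where "\<alpha> = Sup ((\<lambda>i. real_of_int (l i) / real i) ` {0<..})"
  have al: "real_of_int (l i) \<le> real i * \<alpha>" "real i * \<alpha> \<le> real_of_int (l i) + 1" for i
  proof -
    show "real_of_int (l i) \<le> real i * \<alpha>"
    proof (cases "i = 0")
      case True then show ?thesis using l'(1)[of 0 0] by (simp add: D_def)
    next
      case False
      have "real_of_int (l i) / real i \<le> \<alpha>" unfolding \<alpha>_def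
        using cross'[of _ 1] False by (intro cSup_upper bdd_aboveI[of _ "(real_of_int (l 1) + 1) / real 1"]) auto
      then show ?thesis using False by (simp add: field_simps)
    qed
    show "real i * \<alpha> \<le> real_of_int (l i) + 1"
    proof (cases "i = 0")
      case True then show ?thesis using l'(2)[of 0 0] by (simp add: D_def)
    next
      case False
      have "\<alpha> \<le> (real_of_int (l i) + 1) / real i" unfolding \<alpha>_def
        using cross' False by (intro cSup_least) auto
      then show ?thesis using False by (simp add: field_simps)
    qed
  qed
  have D: "real_of_int (D m n) \<le> real n * \<alpha> + 1" "real n * \<alpha> - 1 \<le> real_of_int (D m n)" for m n
  proof -
    have "real_of_int (D m n) \<le> real_of_int (l n) + 1" "real_of_int (l n) \<le> D m n" using l'[of m n] l'(1)[of n m] by linarith+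
    then show "real_of_int (D m n) \<le> real n * \<alpha> + 1" "real n * \<alpha> - 1 \<le> real_of_int (D m n)"
      using al[of n] by linarith+
  qed
  define e where "e n = real_of_int (height b w n) - real n * \<alpha>" for n
  define \<rho> where "\<rho> = Sup (range e)"
  have e: "e n \<le> e m + 1" for n m
  proof (cases "m \<le> n")
    case True
    then show ?thesis using D(1)[of m "n - m"] by (simp add: e_def D_def of_nat_diff algebra_simps)
  next
    case False
    then show ?thesis using D(2)[of "m - n" n] by (simp add: e_def D_def of_nat_diff algebra_simps)
  qed
  have "e n \<le> \<rho>" for n
    unfolding \<rho>_def using e[of _ 0] by (intro cSup_upper bdd_aboveI[of _ "e 0 + 1"]) auto
  moreover have "\<rho> \<le> e n + 1" for n
    unfolding \<rho>_def using e by (intro cSup_least) auto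
  ultimately have "real_of_int (height b w n) \<le> real n * \<alpha> + \<rho> \<and> real n * \<alpha> + \<rho> \<le> real_of_int (height b w n) + 1" for n
    unfolding e_def by (smt (verit))
  then have coding: "slope_coding \<alpha> \<rho> b w" unfolding slope_coding_def by blast
  \<comment> \<open>A constant word is periodic, so both letters occur; this forces
    \<open>l 1 = 0\<close> and hence a slope between 0 and 1.\<close>
  obtain m where "w m \<noteq> b"
    using sturmian_not_eventually_periodic[OF st, of 1 0] by fastforce
  then have "l 1 \<le> 0" using l'(1)[of 1 m] by (simp add: D_def)
  obtain m where "w m = b"
    using sturmian_not_eventually_periodic[OF st, of 1 0] sturmian_two_letters(2)[OF st] by (metis zero_less_one)
  then have "l 1 \<ge> 0" using l'(2)[of m 1] by (simp add: D_def)
  have "0 \<le> \<alpha>" "\<alpha> \<le> 1" using al[of 1] \<open>l 1 \<le> 0\<close> \<open>l 1 \<ge> 0\<close> by auto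
  then show thesis using that coding l unfolding D_def by blast
qed

lemma eventually_constant_int:
  fixes T :: "nat \<Rightarrow> int"
  assumes mono: "\<And>m. T m \<le> T (Suc m)" and bdd: "\<And>m. T m \<le> C"
  obtains N where "\<And>m. m \<ge> N \<Longrightarrow> T m = T N"
proof -
  have "finite (range T)"
  proof (rule finite_subset)
    have "T 0 \<le> T m" for m using lift_Suc_mono_le[of T 0 m] mono by simp
    then show "range T \<subseteq> {T 0..C}" using bdd by auto
  qed simp
  then obtain N where "T N = Max (range T)" by (metis Max_in UNIV_not_empty image_is_empty rangeE)
  then have "T m \<le> T N" for m using \<open>finite (range T)\<close> by simp
  then have "T m = T N" if "m \<ge> N" for m
    using lift_Suc_mono_le[of T N m] mono that by (simp add: antisym)
  then show thesis using that by blast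
qed

text \<open>For a rational slope \<open>p / q\<close>, the excess \<open>f m\<close> over
  \<open>p\<close> of the number of \<open>b\<close> in the block of length \<open>q\<close> at
  \<open>m\<close> has constant sign, and its partial sums are bounded. Hence it is eventually 0 and
  the word is eventually periodic.\<close>

lemma slope_irrational:
  assumes st: "sturmian {a, b} w" and sl: "slope_coding \<alpha> \<rho> b w"
    and two: "\<And>n. \<exists>l. \<forall>m. height b w (m + n) - height b w m \<in> {l, l + 1}"
  shows "\<alpha> \<notin> \<rat>"
proof
  assume "\<alpha> \<in> \<rat>"
  then obtain p' q' where "q' > 0" "\<alpha> = of_int p' / of_int q'" by (meson Rats_cases')
  then obtain p q where pq: "q > 0" "real q * \<alpha> = real_of_int p"
    by (intro that[of "nat q'" p']) auto
  define f where "f m = height b w (m + q) - height b w m - p" for m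
  \<comment> \<open>A discrete primitive of \<open>f\<close>: averaging over \<open>q\<close>
    consecutive heights makes the increment of \<open>T\<close> exactly \<open>f m\<close>, and
    \<open>slope_coding\<close> bounds \<open>T\<close>.\<close>
  define T where "T m = (\<Sum>r<q. height b w (m + r)) - p * m" for m
  have T_Suc: "T (Suc m) = T m + f m" for m
  proof -
    have "(\<Sum>r<q. height b w (m + Suc r)) + height b w m = (\<Sum>r<q. height b w (m + r)) + height b w (m + q)"
      by (induction q) auto
    then show ?thesis unfolding T_def f_def by (simp add: algebra_simps)
  qed
  define C where "C = (\<Sum>r<q. \<bar>real r * \<alpha>\<bar> + \<bar>\<rho>\<bar> + 1)"
  have T_bound: "\<bar>real_of_int (T m)\<bar> \<le> C" for m
  proof -
    have "real_of_int (T m) = (\<Sum>r<q. real_of_int (height b w (m + r)) - real m * \<alpha>)"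
      unfolding T_def using pq by (simp add: sum_subtractf algebra_simps)
    also have "\<bar>\<dots>\<bar> \<le> (\<Sum>r<q. \<bar>real r * \<alpha>\<bar> + \<bar>\<rho>\<bar> + 1)"
    proof (rule order.trans[OF sum_abs sum_mono])
      fix r
      have "real_of_int (height b w (m + r)) \<le> real (m + r) * \<alpha> + \<rho>"
        "real (m + r) * \<alpha> + \<rho> \<le> real_of_int (height b w (m + r)) + 1"
        using sl unfolding slope_coding_def by blast+
      then show "\<bar>real_of_int (height b w (m + r)) - real m * \<alpha>\<bar> \<le> \<bar>real r * \<alpha>\<bar> + \<bar>\<rho>\<bar> + 1"
        by (simp add: algebra_simps abs_if split: if_splits)
    qed
    finally show ?thesis unfolding C_def .
  qed
  have T_bound': "T m \<le> \<lceil>C\<rceil>" "- T m \<le> \<lceil>C\<rceil>" for m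
    using T_bound[of m] by linarith+
  obtain l where l: "\<And>m. f m + p \<in> {l, l + 1}" using two[of q] unfolding f_def by auto
  have "\<exists>N. \<forall>m\<ge>N. f m = 0"
  \<comment> \<open>The values of \<open>f\<close> lie among the consecutive integers
    \<open>l - p\<close> and \<open>l + 1 - p\<close>, so they never have opposite signs.\<close>
  proof (cases "p \<le> l")
    case True
    then have "f m \<ge> 0" for m using l[of m] by auto
    then obtain N where "\<And>m. m \<ge> N \<Longrightarrow> T m = T N"
      using eventually_constant_int[of T, OF _ T_bound'(1)] T_Suc by (metis le_add_same_cancel1)
    then show ?thesis using T_Suc by (metis add_cancel_left_right le_SucI)
  next
    case False
    then have "f m \<le> 0" for m using l[of m] by auto
    then obtain N where "\<And>m. m \<ge> N \<Longrightarrow> - T m = - T N"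
      using eventually_constant_int[of "\<lambda>m. - T m", OF _ T_bound'(2)] T_Suc
      by (metis add_le_same_cancel1 neg_le_iff_le)
    then show ?thesis using T_Suc by (metis add_cancel_left_right le_SucI neg_equal_iff_equal)
  qed
  then obtain N where N: "\<And>m. m \<ge> N \<Longrightarrow> f m = 0" by blast
  show False
  proof (rule sturmian_not_eventually_periodic[OF st pq(1)])
    show "w (m + q) = w m" if "m \<ge> N" for m
    proof -
      have "w (m + q) = b \<longleftrightarrow> w m = b"
        using N[of m] N[of "Suc m"] that by (auto simp: f_def split: if_splits)
      then show ?thesis using sturmian_two_letters(2)[OF st] by metis
    qed
  qed
qed

lemma sturmian_slope_coding:
  assumes st: "sturmian {a, b} w"
  obtains \<alpha> \<rho> where "\<alpha> \<notin> \<rat>" "0 < \<alpha>" "\<alpha> < 1" "slope_coding \<alpha> \<rho> b w"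
proof -
  obtain \<alpha> \<rho> where *: "0 \<le> \<alpha>" "\<alpha> \<le> 1" "slope_coding \<alpha> \<rho> b w"
    "\<And>n. \<exists>l. \<forall>m. height b w (m + n) - height b w m \<in> {l, l + 1}"
    using sturmian_slope_coding_aux[OF st] by metis
  then have irr: "\<alpha> \<notin> \<rat>" using slope_irrational[OF st] by blast
  then have "\<alpha> \<noteq> 0" "\<alpha> \<noteq> 1" by auto
  then show thesis using that[OF irr _ _ *(3)] * by linarith
qed

section \<open>Codings with irrational slope\<close>

locale irrational_slope =
  fixes \<alpha> :: real
  assumes irrational: "\<alpha> \<notin> \<rat>" and pos: "0 < \<alpha>" and less_1: "\<alpha> < 1"
begin

definition flr :: "int \<Rightarrow> int" where "flr m = \<lfloor>real_of_int m * \<alpha>\<rfloor>"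
definition ceil :: "int \<Rightarrow> int" where "ceil m = \<lceil>real_of_int m * \<alpha>\<rceil>"

lemma multiple_not_Ints: "m \<noteq> 0 \<Longrightarrow> real_of_int m * \<alpha> \<notin> \<int>"
proof
  assume "m \<noteq> 0" "real_of_int m * \<alpha> \<in> \<int>"
  then obtain z where "real_of_int m * \<alpha> = real_of_int z" by (auto elim: Ints_cases)
  then have "\<alpha> = real_of_int z / real_of_int m" using \<open>m \<noteq> 0\<close> by (simp add: field_simps)
  then show False using irrational by simp
qed

lemma flr_0 [simp]: "flr 0 = 0" by (simp add: flr_def)
lemma ceil_0 [simp]: "ceil 0 = 0" by (simp add: ceil_def)
lemma flr_1 [simp]: "flr 1 = 0" using pos less_1 by (simp add: flr_def floor_eq_iff)
lemma flr_minus_1 [simp]: "flr (-1) = -1" using pos less_1 by (simp add: flr_def floor_eq_iff)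

lemma ceil_eq: "m \<noteq> 0 \<Longrightarrow> ceil m = flr m + 1"
  using multiple_not_Ints[of m] by (metis ceil_def flr_def ceiling_altdef Ints_of_int)

lemma flr_minus: "m \<noteq> 0 \<Longrightarrow> flr (- m) = - flr m - 1"
  using ceil_eq[of m] by (simp add: flr_def ceil_def ceiling_def)

lemma flr_Suc: "flr (m + 1) = flr m \<or> flr (m + 1) = flr m + 1"
proof -
  have "real_of_int (m + 1) * \<alpha> = real_of_int m * \<alpha> + \<alpha>" by (simp add: algebra_simps)
  then show ?thesis unfolding flr_def using pos less_1 by linarith
qed

lemma ceil_Suc: "ceil (m + 1) = ceil m \<or> ceil (m + 1) = ceil m + 1"
proof -
  have "real_of_int (m + 1) * \<alpha> = real_of_int m * \<alpha> + \<alpha>" by (simp add: algebra_simps)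
  then show ?thesis unfolding ceil_def using pos less_1 by linarith
qed

text \<open>
  The coding of the orbit segment from \<open>-k\<alpha>\<close> to \<open>k\<alpha>\<close>, where \<open>H\<close> is \<open>flr\<close> or \<open>ceil\<close>: the two
  one-sided limits of the coding at a point whose orbit meets the discontinuity \<open>0\<close> in the middle.
\<close>

definition central :: "'a \<Rightarrow> 'a \<Rightarrow> (int \<Rightarrow> int) \<Rightarrow> nat \<Rightarrow> 'a list" where
  "central a b H k =
     map (\<lambda>i. if H (int i + 1 - int k) = H (int i - int k) + 1 then b else a) [0..<2*k]"

text \<open>The prefix of the characteristic word of slope \<alpha>; its coding starts at the orbit
  point \<alpha>, not at 0.\<close>

definition slope_prefix :: "'a \<Rightarrow> 'a \<Rightarrow> nat \<Rightarrow> 'a list" where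
  "slope_prefix a b n =
     map (\<lambda>j. if flr (int j + 2) = flr (int j + 1) + 1 then b else a) [0..<n]"

lemma length_slope_prefix [simp]: "length (slope_prefix a b n) = n"
  by (simp add: slope_prefix_def)

text \<open>The assumptions say that the increments of \<open>H\<close> right of 0 are those of
  \<open>flr\<close>, and that those left of 0 are their mirror image. Only the two steps adjacent
  to 0 depend on the choice of \<open>H\<close>.\<close>

lemma central_eq:
  assumes "\<And>m. m > 0 \<Longrightarrow> H (m + 1) = H m + 1 \<longleftrightarrow> flr (m + 1) = flr m + 1"
    and "\<And>m. m > 0 \<Longrightarrow> H (- m) = H (- m - 1) + 1 \<longleftrightarrow> flr (m + 1) = flr m + 1"
  shows "central a b H (Suc n) =
    rev (slope_prefix a b n) @
    [if H 0 = H (- 1) + 1 then b else a, if H 1 = H 0 + 1 then b else a] @ slope_prefix a b n"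
    (is "?l = ?r")
proof (rule nth_equalityI)
  show "length ?l = length ?r" by (simp add: central_def)
  fix i assume "i < length ?l"
  then have i: "i < 2 * Suc n" by (simp add: central_def)
  have l: "?l ! i = (if H (int i - int n) = H (int i - int n - 1) + 1 then b else a)"
    using i by (simp add: central_def algebra_simps del: upt_Suc)
  consider "i < n" | "i = n" | "i = Suc n" | "i > Suc n" by linarith
  then show "?l ! i = ?r ! i"
  proof cases
    case 1
    define m where "m = int (n - i)"
    have m: "int i - int n = - m" "int (n - Suc i) + 2 = m + 1" "int (n - Suc i) + 1 = m" "m > 0"
      using 1 by (auto simp: m_def)
    have "?r ! i = (if flr (int (n - Suc i) + 2) = flr (int (n - Suc i) + 1) + 1 then b else a)"
      using 1 by (simp add: nth_append rev_nth slope_prefix_def)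
    then show ?thesis unfolding l m using assms(2)[OF m(4)] by simp
  next
    case 2
    then show ?thesis unfolding l by (simp add: nth_append)
  next
    case 3
    then show ?thesis unfolding l by (simp add: nth_append)
  next
    case 4
    define m where "m = int i - int n - 1"
    have m: "int (i - Suc (Suc n)) + 2 = m + 1" "int (i - Suc (Suc n)) + 1 = m" "m > 0"
      "int i - int n = m + 1" "m + 1 - 1 = m"
      using 4 by (auto simp: m_def)
    have "i - n = Suc (Suc (i - Suc (Suc n)))" using 4 by simp
    then have "?r ! i = slope_prefix a b n ! (i - Suc (Suc n))"
      using 4 by (simp add: nth_append)
    also have "\<dots> = (if flr (int (i - Suc (Suc n)) + 2) = flr (int (i - Suc (Suc n)) + 1) + 1 then b else a)"
      using 4 i by (simp add: slope_prefix_def)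
    finally show ?thesis unfolding l m using assms(1)[OF m(3)] by simp
  qed
qed

text \<open>The mirror symmetry comes from \<open>flr (- m) = - flr m - 1\<close>. At 0,
  \<open>flr\<close> rises on entering and not on leaving, whence \<open>ba\<close>; for
  \<open>ceil\<close> it is the other way round.\<close>

lemma central_flr: "central a b flr (Suc n) = rev (slope_prefix a b n) @ [b, a] @ slope_prefix a b n"
proof -
  have "flr (- m) = flr (- m - 1) + 1 \<longleftrightarrow> flr (m + 1) = flr m + 1" if "m > 0" for m
    using that flr_minus[of m] flr_minus[of "m + 1"] by auto
  then show ?thesis by (subst central_eq) auto
qed

lemma central_ceil: "central a b ceil (Suc n) = rev (slope_prefix a b n) @ [a, b] @ slope_prefix a b n"
proof -
  have "ceil (- m) = ceil (- m - 1) + 1 \<longleftrightarrow> flr (m + 1) = flr m + 1" if "m > 0" for m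
    using that flr_minus[of m] flr_minus[of "m + 1"] ceil_eq[of "- m"] ceil_eq[of "- m - 1"] by auto
  moreover have "ceil (m + 1) = ceil m + 1 \<longleftrightarrow> flr (m + 1) = flr m + 1" if "m > 0" for m
    using that ceil_eq[of m] ceil_eq[of "m + 1"] by auto
  ultimately show ?thesis using flr_1 flr_minus_1 by (subst central_eq) (auto simp: ceil_eq)
qed

section \<open>Density of the orbit: central words as factors of every coding\<close>

lemma hit_interval:
  fixes \<beta> lo hi :: real
  assumes "lo < hi"
  obtains n :: nat and p :: int where "lo < real n * \<alpha> + \<beta> - p" "real n * \<alpha> + \<beta> - p < hi"
proof -
  define t where "t = (lo + hi) / 2 - \<beta>"
  obtain n where n: "\<bar>frac (real n * \<alpha>) - frac t\<bar> < (hi - lo) / 2"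
    using Kronecker_approx_1_explicit[OF irrational, of "frac t" "(hi - lo) / 2"] assms
      frac_ge_0[of t] frac_lt_1[of t] by auto
  define p where "p = \<lfloor>real n * \<alpha>\<rfloor> - \<lfloor>t\<rfloor>"
  have "frac (real n * \<alpha>) - frac t = real n * \<alpha> + \<beta> - p - (lo + hi) / 2"
    by (simp add: frac_def p_def t_def)
  then have "\<bar>real n * \<alpha> + \<beta> - p - (lo + hi) / 2\<bar> < (hi - lo) / 2" using n by simp
  then have "lo < real n * \<alpha> + \<beta> - p" "real n * \<alpha> + \<beta> - p < hi"
    by (auto simp: abs_less_iff field_simps)
  then show thesis by (rule that)
qed

text \<open>Finitely many non-zero multiples of \<alpha>, none an integer, keep a positive distance
  from the integers.\<close>

lemma multiples_away_from_Ints: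
  obtains \<delta> where "0 < \<delta>" "\<delta> \<le> 1"
    "\<And>m. m \<noteq> 0 \<Longrightarrow> \<bar>m\<bar> \<le> int k \<Longrightarrow> \<delta> \<le> frac (real_of_int m * \<alpha>) \<and> frac (real_of_int m * \<alpha>) \<le> 1 - \<delta>"
proof -
  define A where "A = {m. m \<noteq> 0 \<and> \<bar>m\<bar> \<le> int k}"
  define d where "d m = min (frac (real_of_int m * \<alpha>)) (1 - frac (real_of_int m * \<alpha>))" for m
  define \<delta> where "\<delta> = Min (insert 1 (d ` A))"
  have "finite A" unfolding A_def by (rule finite_subset[of _ "{- int k..int k}"]) auto
  moreover have "0 < d m" if "m \<in> A" for m
  proof -
    have "frac (real_of_int m * \<alpha>) \<noteq> 0"
      using that multiple_not_Ints[of m] by (simp add: A_def)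
    then have "0 < frac (real_of_int m * \<alpha>)" using frac_ge_0[of "real_of_int m * \<alpha>"] by linarith
    then show ?thesis using frac_lt_1[of "real_of_int m * \<alpha>"] by (simp add: d_def)
  qed
  ultimately have "0 < \<delta>" "\<delta> \<le> 1" "\<And>m. m \<in> A \<Longrightarrow> \<delta> \<le> d m"
    unfolding \<delta>_def by (auto simp: Min_gr_iff)
  then have "\<delta> \<le> d m" if "m \<noteq> 0" "\<bar>m\<bar> \<le> int k" for m using that by (simp add: A_def)
  then show thesis using \<open>0 < \<delta>\<close> \<open>\<delta> \<le> 1\<close>
    by (intro that[of \<delta>]) (auto simp: d_def le_diff_eq add.commute)
qed

lemma central_eq_block:
  assumes "\<And>i. w i = a \<or> w i = b" and "a \<noteq> b"
    and "\<And>i. i \<le> 2 * k \<Longrightarrow> height b w (n + i) = c + H (int i - int k)"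
  shows "block w n (2 * k) = central a b H k"
proof (rule nth_equalityI)
  fix i assume "i < length (block w n (2 * k))"
  then have i: "i < 2 * k" by simp
  have "height b w (n + Suc i) = height b w (n + i) + (if w (n + i) = b then 1 else 0)" by simp
  then have "H (int i + 1 - int k) = H (int i - int k) + (if w (n + i) = b then 1 else 0)"
    using assms(3)[of i] assms(3)[of "Suc i"] i by (simp add: algebra_simps)
  then show "block w n (2 * k) ! i = central a b H k ! i"
    using i assms(1)[of "n + i"] assms(2) by (auto simp: central_def)
qed (simp add: central_def)

text \<open>If the orbit point at index \<open>n + k\<close> lies slightly to the right of an
  integer \<open>p\<close>, by less than \<delta>, then all points with indices from
  \<open>n\<close> to \<open>n + 2 * k\<close> are shifted from \<open>p + m\<alpha>\<close> without
  reaching the next integer. None of them is an integer, so the heights are determined.\<close>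

lemma central_flr_block:
  assumes sl: "slope_coding \<alpha> \<rho> b w" and ab: "\<And>i. w i = a \<or> w i = b" "a \<noteq> b"
  obtains n where "block w n (2 * k) = central a b flr k"
proof -
  obtain \<delta> where d: "0 < \<delta>" "\<delta> \<le> 1"
    "\<And>m. m \<noteq> 0 \<Longrightarrow> \<bar>m\<bar> \<le> int k \<Longrightarrow> \<delta> \<le> frac (real_of_int m * \<alpha>) \<and> frac (real_of_int m * \<alpha>) \<le> 1 - \<delta>"
    using multiples_away_from_Ints by metis
  obtain n :: nat and p :: int where n: "0 < real n * \<alpha> + (\<rho> + real k * \<alpha>) - p"
    "real n * \<alpha> + (\<rho> + real k * \<alpha>) - p < \<delta>"
    using hit_interval[OF d(1), of "\<rho> + real k * \<alpha>"] by auto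
  define \<epsilon> where "\<epsilon> = real n * \<alpha> + (\<rho> + real k * \<alpha>) - p"
  have "height b w (n + i) = p + flr (int i - int k)" if "i \<le> 2 * k" for i
  proof -
    define m where "m = int i - int k"
    define y where "y = real (n + i) * \<alpha> + \<rho>"
    have "frac (real_of_int m * \<alpha>) \<le> 1 - \<delta>"
      using d(3)[of m] d(2) that by (cases "m = 0") (auto simp: m_def)
    moreover have "real_of_int (height b w (n + i)) \<le> y" "y \<le> real_of_int (height b w (n + i)) + 1"
      using sl unfolding slope_coding_def y_def by blast+
    moreover have "y = \<epsilon> + real_of_int p + real_of_int (flr m) + frac (real_of_int m * \<alpha>)"
      unfolding y_def \<epsilon>_def flr_def frac_def m_def by (simp add: algebra_simps)
    moreover have "0 < \<epsilon>" "\<epsilon> < \<delta>" using n unfolding \<epsilon>_def by auto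
    moreover note frac_ge_0[of "real_of_int m * \<alpha>"]
    ultimately have "height b w (n + i) < p + flr m + 1" "p + flr m < height b w (n + i) + 1"
      by linarith+
    then show ?thesis unfolding m_def by simp
  qed
  then have "block w n (2 * k) = central a b flr k" by (rule central_eq_block[OF ab])
  then show thesis by (rule that)
qed

text \<open>The same approach from the left of \<open>p\<close>. The offset \<open>p - 1\<close> in
  the heights is due to the middle point lying just below \<open>p\<close>.\<close>

lemma central_ceil_block:
  assumes sl: "slope_coding \<alpha> \<rho> b w" and ab: "\<And>i. w i = a \<or> w i = b" "a \<noteq> b"
  obtains n where "block w n (2 * k) = central a b ceil k"
proof -
  obtain \<delta> where d: "0 < \<delta>" "\<delta> \<le> 1"
    "\<And>m. m \<noteq> 0 \<Longrightarrow> \<bar>m\<bar> \<le> int k \<Longrightarrow> \<delta> \<le> frac (real_of_int m * \<alpha>) \<and> frac (real_of_int m * \<alpha>) \<le> 1 - \<delta>"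
    using multiples_away_from_Ints by metis
  obtain n :: nat and p :: int where n: "- \<delta> < real n * \<alpha> + (\<rho> + real k * \<alpha>) - p"
    "real n * \<alpha> + (\<rho> + real k * \<alpha>) - p < 0"
    using hit_interval[of "- \<delta>" 0 "\<rho> + real k * \<alpha>"] d(1) by auto
  define \<epsilon> where "\<epsilon> = real n * \<alpha> + (\<rho> + real k * \<alpha>) - p"
  have "height b w (n + i) = (p - 1) + ceil (int i - int k)" if "i \<le> 2 * k" for i
  proof -
    define m where "m = int i - int k"
    define y where "y = real (n + i) * \<alpha> + \<rho>"
    have "real_of_int (ceil m) - 1 + \<delta> \<le> real_of_int m * \<alpha>"
    proof (cases "m = 0")
      case True then show ?thesis using d(2) by simp
    next
      case False
      then have "\<delta> \<le> frac (real_of_int m * \<alpha>)" using d(3)[of m] that by (simp add: m_def)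
      then show ?thesis using False by (simp add: ceil_eq flr_def frac_def)
    qed
    moreover have "real_of_int m * \<alpha> \<le> real_of_int (ceil m)" by (simp add: ceil_def)
    moreover have "real_of_int (height b w (n + i)) \<le> y" "y \<le> real_of_int (height b w (n + i)) + 1"
      using sl unfolding slope_coding_def y_def by blast+
    moreover have "y = \<epsilon> + real_of_int p + real_of_int m * \<alpha>"
      unfolding y_def \<epsilon>_def m_def by (simp add: algebra_simps)
    moreover have "- \<delta> < \<epsilon>" "\<epsilon> < 0" using n unfolding \<epsilon>_def by auto
    ultimately have "height b w (n + i) < p + ceil m" "p + ceil m - 1 < height b w (n + i) + 1"
      by linarith+
    then show ?thesis unfolding m_def by simp
  qed
  then have "block w n (2 * k) = central a b ceil k" by (rule central_eq_block[OF ab])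
  then show thesis by (rule that)
qed

text \<open>The orbit segments of these windows all pass through 0. Equal windows have equal
  increments of \<open>H\<close>; comparing both when either reaches 0 gives
  \<open>H d + H (- d) = 0\<close> for the difference \<open>d\<close> of their starts, so
  \<open>d = 0\<close>.\<close>

lemma central_windows_distinct:
  assumes H: "H 0 = 0" "\<And>m. m \<noteq> 0 \<Longrightarrow> H m + H (- m) \<noteq> 0"
    "\<And>m. H (m + 1) = H m \<or> H (m + 1) = H m + 1"
    and ab: "a \<noteq> b" and n: "n \<le> k"
  shows "inj_on (\<lambda>i. take n (drop i (central a b H k))) {k - n..k}"
proof (rule inj_onI)
  fix i i' assume i: "i \<in> {k - n..k}" "i' \<in> {k - n..k}"
    and eq: "take n (drop i (central a b H k)) = take n (drop i' (central a b H k))"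
  have step: "H (int i + int j + 1 - int k) - H (int i + int j - int k) =
      H (int i' + int j + 1 - int k) - H (int i' + int j - int k)" if "j < n" for j
  proof -
    have "central a b H k ! (i + j) = central a b H k ! (i' + j)"
      using arg_cong[OF eq, of "\<lambda>x. x ! j"] that i n by (simp add: central_def)
    then show ?thesis
      using that i n ab H(3)[of "int i + int j - int k"] H(3)[of "int i' + int j - int k"]
      by (auto simp: central_def algebra_simps split: if_splits)
  qed
  have "H (int i + int j - int k) - H (int i - int k) = H (int i' + int j - int k) - H (int i' - int k)"
    if "j \<le> n" for j
    using that
  proof (induction j)
    case (Suc j)
    then show ?case using step[of j] by (simp add: algebra_simps)
  qed simp
  from this[of "k - i"] this[of "k - i'"] i
  have "H 0 - H (int i - int k) = H (- (int i - int i')) - H (int i' - int k)"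
    "H (int i - int i') - H (int i - int k) = H 0 - H (int i' - int k)"
    by (auto simp: of_nat_diff)
  then have "H (int i - int i') + H (- (int i - int i')) = 0" using H(1) by simp
  then show "i = i'" using H(2)[of "int i - int i'"] by (cases "int i - int i' = 0") auto
qed

lemma flr_windows_distinct:
  assumes "a \<noteq> b" "n \<le> k"
  shows "inj_on (\<lambda>i. take n (drop i (central a b flr k))) {k - n..k}"
proof (rule central_windows_distinct[OF _ _ _ assms])
  show "flr m + flr (- m) \<noteq> 0" if "m \<noteq> 0" for m using flr_minus[OF that] by simp
qed (simp, rule flr_Suc)

lemma ceil_windows_distinct:
  assumes "a \<noteq> b" "n \<le> k"
  shows "inj_on (\<lambda>i. take n (drop i (central a b ceil k))) {k - n..k}"
proof (rule central_windows_distinct[OF _ _ _ assms])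
  show "ceil m + ceil (- m) \<noteq> 0" if "m \<noteq> 0" for m
    using flr_minus[OF that] ceil_eq[OF that] ceil_eq[of "- m"] that by simp
qed (simp, rule ceil_Suc)

end

lemma take_drop_block:
  "i + n \<le> m \<Longrightarrow> take n (drop i (block w p m)) = block w (p + i) n"
  by (simp add: list_eq_iff_nth_eq add.assoc)

section \<open>Mechanical words are Sturmian\<close>

context irrational_slope
begin

definition mechanical :: "'a \<Rightarrow> 'a \<Rightarrow> 'a word" where
  "mechanical a b n = (if flr (int n + 1) = flr (int n) + 1 then b else a)"

lemma mechanical_letters: "mechanical a b i = a \<or> mechanical a b i = b"
  by (simp add: mechanical_def)

lemma height_mechanical:
  assumes "a \<noteq> b" shows "height b (mechanical a b) n = flr (int n)"
proof (induction n)
  case (Suc n)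
  then show ?case using assms flr_Suc[of "int n"] by (auto simp: mechanical_def add.commute)
qed simp

lemma mechanical_slope_coding:
  assumes "a \<noteq> b" shows "slope_coding \<alpha> 0 b (mechanical a b)"
  unfolding slope_coding_def height_mechanical[OF assms] flr_def by (simp; linarith)

text \<open>
  Along the orbit, all the heights of a block are non-decreasing functions of \<open>frac (i\<alpha>)\<close>, hence
  the block is determined by their sum, which takes at most \<open>n + 1\<close> values.
\<close>

lemma mechanical_card_blocks_le:
  assumes ab: "a \<noteq> b"
  shows "finite (range (\<lambda>i. block (mechanical a b) i n))"
    and "card (range (\<lambda>i. block (mechanical a b) i n)) \<le> n + 1"
proof -
  define w where "w = mechanical a b"
  define f where "f i j = \<lfloor>frac (real i * \<alpha>) + real j * \<alpha>\<rfloor>" for i j :: nat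
  define \<Psi> where "\<Psi> i = (\<Sum>j=1..n. f i j)" for i
  define C where "C = (\<Sum>j=1..n. flr (int j))"
  have f: "height b w (i + j) = flr (int i) + f i j" for i j
  proof -
    have "real (i + j) * \<alpha> = frac (real i * \<alpha>) + real j * \<alpha> + of_int \<lfloor>real i * \<alpha>\<rfloor>"
      by (simp add: frac_def algebra_simps)
    then show ?thesis
      unfolding w_def height_mechanical[OF ab] f_def flr_def by simp
  qed
  have f_bounds: "flr (int j) \<le> f i j" "f i j \<le> flr (int j) + 1" for i j
    unfolding flr_def f_def using frac_ge_0[of "real i * \<alpha>"] frac_lt_1[of "real i * \<alpha>"]
    by (simp_all only: of_int_of_nat_eq) linarith+
  \<comment> \<open>Each of the \<open>n\<close> summands has two possible values, so the sum ranges
    over \<open>n + 1\<close> integers starting from \<open>C\<close>.\<close>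
  have "\<Psi> i \<le> (\<Sum>j=1..n. flr (int j) + 1)" for i
    unfolding \<Psi>_def by (intro sum_mono f_bounds)
  moreover have "C \<le> \<Psi> i" for i
    unfolding \<Psi>_def C_def by (intro sum_mono f_bounds)
  ultimately have "\<Psi> i \<in> {C..C + int n}" for i
    by (simp add: C_def sum.distrib)
  then have range: "range \<Psi> \<subseteq> {C..C + int n}" by blast
  have aux: "block w i n = block w i' n" if eq: "\<Psi> i = \<Psi> i'" and le: "frac (real i * \<alpha>) \<le> frac (real i' * \<alpha>)" for i i'
  proof -
    \<comment> \<open>Termwise inequality together with equal sums forces termwise equality.\<close>
    have "f i j = f i' j" if "j \<in> {1..n}" for j
      using sum_mono_inv[of "f i" "{1..n}" "f i'" j] eq le that
      by (simp add: \<Psi>_def f_def floor_mono)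
    moreover have "f i 0 = f i' 0" using f[of i 0] f[of i' 0] by (simp add: w_def height_mechanical[OF ab])
    ultimately have fj: "f i j = f i' j" if "j \<le> n" for j using that by (cases "j = 0") auto
    have "w (i + j) = w (i' + j)" if "j < n" for j
    proof -
      have "w (i + j) = b \<longleftrightarrow> f i (Suc j) = f i j + 1" "w (i' + j) = b \<longleftrightarrow> f i' (Suc j) = f i' j + 1"
        using f[of i j] f[of i "Suc j"] f[of i' j] f[of i' "Suc j"] by (auto split: if_splits)
      then have "w (i + j) = b \<longleftrightarrow> w (i' + j) = b" using fj[of j] fj[of "Suc j"] that by simp
      then show ?thesis using mechanical_letters[of a b] unfolding w_def by metis
    qed
    then show ?thesis unfolding block_eq_iff by blast
  qed
  have det: "block w i n = block w i' n" if "\<Psi> i = \<Psi> i'" for i i'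
    using aux[of i i'] aux[of i' i] that by (metis linear)
  define g where "g s = block w (SOME i. \<Psi> i = s) n" for s
  have "block w i n = g (\<Psi> i)" for i
    unfolding g_def by (rule det) (metis (mono_tags, lifting) someI)
  then have sub: "range (\<lambda>i. block w i n) \<subseteq> g ` {C..C + int n}" using range by auto
  then show "finite (range (\<lambda>i. block (mechanical a b) i n))"
    unfolding w_def by (rule finite_subset) simp
  have "card (range (\<lambda>i. block w i n)) \<le> card (g ` {C..C + int n})"
    using sub by (rule card_mono[rotated]) simp
  also have "\<dots> \<le> card {C..C + int n}" by (rule card_image_le) simp
  finally show "card (range (\<lambda>i. block (mechanical a b) i n)) \<le> n + 1" unfolding w_def by simp
qed

text \<open>The upper bound on the number of blocks is \<open>mechanical_card_blocks_le\<close>. The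
  lower bound comes from a central word of length \<open>2 * n\<close>, a factor with
  \<open>n + 1\<close> distinct windows through its middle.\<close>

lemma mechanical_sturmian:
  assumes ab: "a \<noteq> b" shows "sturmian {a, b} (mechanical a b)"
  unfolding sturmian_def factors_of_length
proof (intro conjI allI)
  show "card {a, b} = 2" using ab by simp
  show "range (mechanical a b) \<subseteq> {a, b}" using mechanical_letters by fastforce
  fix n
  obtain p where p: "block (mechanical a b) p (2 * n) = central a b flr n"
    using central_flr_block[OF mechanical_slope_coding[OF ab] mechanical_letters ab] .
  let ?g = "\<lambda>i. take n (drop i (central a b flr n))"
  have "?g i = block (mechanical a b) (p + i) n" if "i \<in> {n - n..n}" for i
    unfolding p[symmetric] using that by (intro take_drop_block) simp
  then have "?g ` {n - n..n} \<subseteq> range (\<lambda>i. block (mechanical a b) i n)" by auto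
  then have "card (?g ` {n - n..n}) \<le> card (range (\<lambda>i. block (mechanical a b) i n))"
    using mechanical_card_blocks_le(1)[OF ab] by (rule card_mono[rotated])
  moreover have "card (?g ` {n - n..n}) = n + 1"
    using card_image[OF flr_windows_distinct[OF ab order_refl[of n]]] by simp
  ultimately show "card (range (\<lambda>i. block (mechanical a b) i n)) = n + 1"
    using mechanical_card_blocks_le(2)[OF ab, of n] by simp
qed

section \<open>Right special factors of a slope coding\<close>

lemma slope_prefix_unique:
  assumes "set y \<subseteq> {a, b}" "a \<noteq> b"
    and cnt: "\<And>i. i \<le> length y \<Longrightarrow> int (count_list (take i y) b) = flr (int i + 1)"
  shows "y = slope_prefix a b (length y)"
proof (rule nth_equalityI)
  fix j assume j: "j < length y"
  have "count_list (take (Suc j) y) b = count_list (take j y) b + (if y ! j = b then 1 else 0)"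
    using j by (simp add: take_Suc_conv_app_nth)
  then have "flr (int j + 2) = flr (int j + 1) + (if y ! j = b then 1 else 0)"
    using cnt[of j] cnt[of "Suc j"] j by (simp add: algebra_simps split: if_splits)
  moreover have "y ! j = a \<or> y ! j = b" using assms(1) nth_mem[OF j] by auto
  ultimately show "y ! j = slope_prefix a b (length y) ! j"
    using j assms(2) by (auto simp: slope_prefix_def split: if_splits)
qed simp

lemma count_rev_block:
  "i \<le> n \<Longrightarrow> int (count_list (take i (rev (block w p n))) b) = height b w (p + n) - height b w (p + n - i)"
proof (induction i)
  case (Suc i)
  have "rev (block w p n) ! i = w (p + n - Suc i)" using Suc.prems by (simp add: rev_nth)
  moreover have "p + n - i = Suc (p + n - Suc i)" using Suc.prems by simp
  ultimately show ?case using Suc by (simp add: take_Suc_conv_app_nth)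
qed simp

text \<open>Let the suffix of \<open>x\<close> of length \<open>i\<close> contain \<open>c\<close>
  letters \<open>b\<close>. Followed by \<open>a\<close> and by \<open>b\<close>, it yields blocks
  of length \<open>i + 1\<close> with \<open>c\<close> and \<open>c + 1\<close> letters
  \<open>b\<close>. Both counts are within 1 of \<open>(i + 1)\<alpha>\<close>, so \<open>c\<close>
  is its floor by irrationality.\<close>

lemma right_special_eq:
  assumes sl: "slope_coding \<alpha> \<rho> b w" and ab: "\<And>i. w i = a \<or> w i = b" "a \<noteq> b"
    and rs: "right_special w x"
  shows "x = rev (slope_prefix a b (length x))"
proof -
  define n where "n = length x"
  obtain c d where cd: "c \<noteq> d" "x @ [c] \<in> factors w" "x @ [d] \<in> factors w"
    using rs unfolding right_special_def by blast
  then obtain p' q' where "x @ [c] = block w p' (Suc n)" "x @ [d] = block w q' (Suc n)"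
    unfolding factors_iff_block n_def by auto
  then have "x = block w p' n" "w (p' + n) = c" "x = block w q' n" "w (q' + n) = d"
    by (auto simp: block_Suc)
  then obtain p q where p: "x = block w p n" "w (p + n) = a" and q: "x = block w q n" "w (q + n) = b"
    using ab cd(1) by metis
  have diff: "real_of_int (height b w (m + l) - height b w m) \<le> real l * \<alpha> + 1"
    "real l * \<alpha> - 1 \<le> real_of_int (height b w (m + l) - height b w m)" for m l
  proof -
    have "real_of_int (height b w (m + l)) \<le> real (m + l) * \<alpha> + \<rho>"
      "real (m + l) * \<alpha> + \<rho> \<le> real_of_int (height b w (m + l)) + 1"
      "real_of_int (height b w m) \<le> real m * \<alpha> + \<rho>"
      "real m * \<alpha> + \<rho> \<le> real_of_int (height b w m) + 1"
      using sl unfolding slope_coding_def by blast+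
    then show "real_of_int (height b w (m + l) - height b w m) \<le> real l * \<alpha> + 1"
      "real l * \<alpha> - 1 \<le> real_of_int (height b w (m + l) - height b w m)"
      by (simp_all add: algebra_simps)
  qed
  have "rev x = slope_prefix a b (length (rev x))"
  proof (rule slope_prefix_unique)
    show "set (rev x) \<subseteq> {a, b}" using p(1) ab by (auto simp: block_def)
    fix i assume "i \<le> length (rev x)"
    then have i: "i \<le> n" by (simp add: n_def)
    define c where "c = int (count_list (take i (rev x)) b)"
    have hp: "c = height b w (p + n) - height b w (p + n - i)"
      unfolding c_def by (subst p(1)) (rule count_rev_block[OF i])
    have hq: "c = height b w (q + n) - height b w (q + n - i)"
      unfolding c_def by (subst q(1)) (rule count_rev_block[OF i])
    have "height b w (p + n - i + Suc i) = height b w (p + n)" "height b w (q + n - i + Suc i) = height b w (q + n) + 1"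
      using p(2) q(2) ab(2) i by simp_all
    then have "real_of_int c \<le> real (Suc i) * \<alpha>" "real (Suc i) * \<alpha> \<le> real_of_int c + 1"
      using diff(2)[of "Suc i" "p + n - i"] diff(1)[of "q + n - i" "Suc i"] hp hq by auto
    moreover have "real_of_int (int i + 1) * \<alpha> \<noteq> real_of_int (c + 1)"
      using multiple_not_Ints[of "int i + 1"] by (metis Ints_of_int of_nat_Suc of_nat_neq_0 add.commute)
    ultimately have "flr (int i + 1) = c"
      unfolding flr_def floor_eq_iff by (simp add: less_le add.commute)
    then show "int (count_list (take i (rev x)) b) = flr (int i + 1)" unfolding c_def by simp
  qed (rule ab)
  then show ?thesis by (metis length_rev rev_rev_ident)
qed

lemma central_in_factors:
  assumes sl: "slope_coding \<alpha> \<rho> b w" and ab: "\<And>i. w i = a \<or> w i = b" "a \<noteq> b"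
  shows "rev (slope_prefix a b n) @ [b, a] @ slope_prefix a b n \<in> factors w"
    and "rev (slope_prefix a b n) @ [a, b] @ slope_prefix a b n \<in> factors w"
  using central_flr_block[OF sl ab, of "Suc n"] central_ceil_block[OF sl ab, of "Suc n"]
  unfolding central_flr central_ceil by (metis block_in_factors)+

end

section \<open>Equivalence of the two central words\<close>

text \<open>The \<open>n + 1\<close> windows are distinct factors of \<open>w\<close>, which has
  only \<open>n + 1\<close> of that length, so each occurs exactly once. The count thus depends on
  \<open>w\<close> and \<open>z\<close> but not on \<open>u\<close>.\<close>

lemma block_window_count:
  assumes card: "card (range (\<lambda>i. block w i n)) = n + 1" and u: "block w p (2 * k) = u"
    and inj: "inj_on (\<lambda>i. take n (drop i u)) {k - n..k}" and "n \<le> k"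
  shows "card {i \<in> {k - n..k}. take n (drop i u) = z} = of_bool (z \<in> range (\<lambda>i. block w i n))"
proof -
  let ?f = "\<lambda>i. take n (drop i u)"
  let ?R = "range (\<lambda>i. block w i n)"
  have "?f i = block w (p + i) n" if "i \<in> {k - n..k}" for i
    unfolding u[symmetric] using that \<open>n \<le> k\<close> by (intro take_drop_block) simp
  then have "?f ` {k - n..k} \<subseteq> ?R" by auto
  moreover have "card (?f ` {k - n..k}) = card ?R"
    unfolding card using card_image[OF inj] \<open>n \<le> k\<close> by simp
  moreover have "finite ?R" using card card_ge_0_finite[of ?R] by simp
  ultimately have img: "?f ` {k - n..k} = ?R" by (metis card_subset_eq)
  show ?thesis
  proof (cases "z \<in> ?R")
    case True
    then have "z \<in> ?f ` {k - n..k}" unfolding img .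
    then obtain i where i: "z = ?f i" "i \<in> {k - n..k}" by (rule imageE)
    have "{i \<in> {k - n..k}. ?f i = z} = {i}"
    proof (intro equalityI subsetI)
      fix j assume "j \<in> {i \<in> {k - n..k}. ?f i = z}"
      then have j: "j \<in> {k - n..k}" "?f j = ?f i" using i(1) by (simp_all only: mem_Collect_eq)
      show "j \<in> {i}" using inj_onD[OF inj j(2) j(1) i(2)] by (simp only: singleton_iff)
    qed (use i in blast)
    then show ?thesis using True by (simp only: is_singletonI is_singleton_altdef[symmetric] of_bool_eq)
  next
    case False
    then have "z \<notin> ?f ` {k - n..k}" unfolding img .
    then have "{i \<in> {k - n..k}. ?f i = z} = {}" by blast
    then show ?thesis using False by (simp only: card.empty of_bool_eq)
  qed
qed

text \<open>The first set collects the windows inside the first or last \<open>k - 1\<close>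
  letters, where words of the forms \<open>xaby\<close> and \<open>xbay\<close> agree.\<close>

lemma occ_count_split:
  assumes "length u = 2 * k" "length z \<le> k"
  shows "occ_count u z =
    card {i \<in> {..<k - length z} \<union> {k<..2 * k - length z}. take (length z) (drop i u) = z} +
    card {i \<in> {k - length z..k}. take (length z) (drop i u) = z}"
proof -
  let ?n = "length z"
  have "{i. i + ?n \<le> length u \<and> take ?n (drop i u) = z} =
    {i \<in> {..<k - ?n} \<union> {k<..2 * k - ?n}. take ?n (drop i u) = z} \<union>
    {i \<in> {k - ?n..k}. take ?n (drop i u) = z}"
    using assms by auto
  then show ?thesis unfolding occ_count_def
    by (simp only:) (rule card_Un_disjoint; auto)
qed

lemma (in irrational_slope) central_k_abelian:
  assumes st: "sturmian {a, b} w" and sl: "slope_coding \<alpha> \<rho> b w"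
  shows "k_abelian_equiv (Suc m) (rev (slope_prefix a b m) @ [a, b] @ slope_prefix a b m)
    (rev (slope_prefix a b m) @ [b, a] @ slope_prefix a b m)"
  unfolding k_abelian_equiv_def
proof (intro allI impI)
  let ?k = "Suc m" and ?y = "slope_prefix a b m"
  let ?u = "rev ?y @ [a, b] @ ?y" and ?v = "rev ?y @ [b, a] @ ?y"
  fix z :: "'a list" assume z: "length z \<le> ?k"
  let ?n = "length z"
  note ab = sturmian_two_letters[OF st]
  obtain p where p: "block w p (2 * ?k) = ?u"
    using central_ceil_block[OF sl ab(2) ab(1), of ?k] unfolding central_ceil .
  obtain q where q: "block w q (2 * ?k) = ?v"
    using central_flr_block[OF sl ab(2) ab(1), of ?k] unfolding central_flr .
  have "card {i \<in> {?k - ?n..?k}. take ?n (drop i ?u) = z} =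
        card {i \<in> {?k - ?n..?k}. take ?n (drop i ?v) = z}"
    using block_window_count[OF sturmian_card_blocks[OF st] p
        ceil_windows_distinct[OF ab(1) z, unfolded central_ceil] z]
      block_window_count[OF sturmian_card_blocks[OF st] q
        flr_windows_distinct[OF ab(1) z, unfolded central_flr] z]
    by (rule trans[OF _ sym])
  moreover have "take ?n (drop i ?u) = take ?n (drop i ?v)"
    if "i \<in> {..<?k - ?n} \<union> {?k<..2 * ?k - ?n}" for i
  proof (cases "i < ?k - ?n")
    case False
    then have "m + 2 \<le> i" using that by auto
    then obtain j where "i = m + 2 + j" using le_Suc_ex by blast
    then show ?thesis by (simp add: numeral_2_eq_2)
  qed (auto)
  then have "{i \<in> {..<?k - ?n} \<union> {?k<..2 * ?k - ?n}. take ?n (drop i ?u) = z} =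
      {i \<in> {..<?k - ?n} \<union> {?k<..2 * ?k - ?n}. take ?n (drop i ?v) = z}"
    by (intro Collect_cong conj_cong refl) simp
  moreover have "length ?u = 2 * ?k" "length ?v = 2 * ?k" by simp_all
  ultimately show "occ_count ?u z = occ_count ?v z"
    using occ_count_split[of ?u ?k z] occ_count_split[of ?v ?k z] z by metis
qed

section \<open>Windows of k-abelian equivalent words\<close>

definition windows :: "'a list \<Rightarrow> nat \<Rightarrow> 'a list list" where
  "windows u n = map (\<lambda>i. take n (drop i u)) [0..<Suc (length u) - n]"

lemma occ_count_windows: "occ_count u x = count (mset (windows u (length x))) x"
proof -
  have "{i. i + length x \<le> length u \<and> take (length x) (drop i u) = x} =
    {i. i < length (windows u (length x)) \<and> x = windows u (length x) ! i}"
    by (auto simp: windows_def simp del: upt_Suc)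
  then show ?thesis
    by (simp add: occ_count_def count_mset count_list_eq_length_filter length_filter_conv_card)
qed

lemma k_abelian_equiv_windows:
  assumes "k_abelian_equiv k u v" "0 < n" "n \<le> k"
  shows "mset (windows u n) = mset (windows v n)"
proof (rule multiset_eqI)
  fix z
  show "count (mset (windows u n)) z = count (mset (windows v n)) z"
  proof (cases "length z = n")
    case True
    then have "occ_count u z = occ_count v z"
      using assms unfolding k_abelian_equiv_def by fastforce
    then show ?thesis unfolding occ_count_windows True .
  next
    case False
    then have "z \<notin> set (windows u' n)" for u' by (auto simp: windows_def)
    then show ?thesis by (metis count_eq_zero_iff set_mset_mset)
  qed
qed

text \<open>Given equal multisets of windows of lengths \<open>n\<close> and \<open>n + 1\<close>,
  cancelling the truncated windows shows that the suffixes of length \<open>n\<close> agree;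
  \<open>windows_tl\<close> does the same for prefixes.\<close>

lemma windows_take:
  assumes "n < length u"
  shows "windows u n = map (take n) (windows u (Suc n)) @ [drop (length u - n) u]"
proof -
  have "Suc (length u) - n = Suc (length u - n)" using assms by simp
  then show ?thesis by (simp add: windows_def)
qed

lemma windows_tl:
  assumes "n < length u"
  shows "windows u n = take n u # map tl (windows u (Suc n))"
proof -
  have "[0..<Suc (length u) - n] = 0 # map Suc [0..<length u - n]"
    using assms by (simp add: Suc_diff_le upt_conv_Cons map_Suc_upt del: upt_Suc)
  moreover have "take n (drop (Suc i) u) = tl (take (Suc n) (drop i u))" for i
    by (simp add: drop_Suc tl_drop tl_take)
  ultimately show ?thesis by (simp add: windows_def del: upt_Suc)
qed

lemma windows_1: "map hd (windows u 1) = u"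
proof (rule nth_equalityI)
  fix i assume "i < length (map hd (windows u 1))"
  then have "i < length u" by (simp add: windows_def)
  then show "map hd (windows u 1) ! i = u ! i"
    by (simp add: windows_def hd_drop_conv_nth hd_take)
qed (simp add: windows_def)

text \<open>Windows of lengths \<open>k - 1\<close> and \<open>k\<close> give a common prefix and
  suffix of length \<open>k - 1\<close>. Letter counts then leave the same two middle letters, which
  must be exchanged since \<open>u\<close> and \<open>v\<close> differ.\<close>

lemma k_abelian_equiv_shape:
  assumes eq: "k_abelian_equiv k u v" and k: "k > 0" and len: "length u = 2 * k" "length v = 2 * k"
    and ne: "u \<noteq> v"
  obtains a b x y where "a \<noteq> b" "length x = k - 1" "length y = k - 1"
    "u = x @ a # b # y" "v = x @ b # a # y"
proof -
  have ms: "mset u = mset v"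
    using arg_cong[OF k_abelian_equiv_windows[OF eq, of 1], of "image_mset hd"] k windows_1
    by (metis mset_map less_one linorder_not_less not_less_zero zero_less_one)
  have ends: "take (k - 1) u = take (k - 1) v \<and> drop (k + 1) u = drop (k + 1) v"
  \<comment> \<open>The equivalence does not speak about windows of length 0, so
    \<open>k - 1 = 0\<close> is treated separately.\<close>
  proof (cases "k = 1")
    case True then show ?thesis using len by simp
  next
    case False
    then have n: "k - 1 > 0" "k - 1 < length u" "k - 1 < length v" "Suc (k - 1) = k" using k len by auto
    have 1: "mset (windows u (k - 1)) = mset (windows v (k - 1))"
      "mset (windows u (Suc (k - 1))) = mset (windows v (Suc (k - 1)))"
      using n k by (auto intro: k_abelian_equiv_windows[OF eq])
    have "take (k - 1) u = take (k - 1) v"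
      using 1 unfolding windows_tl[OF n(2)] windows_tl[OF n(3)] by (simp add: mset_map)
    moreover have "drop (length u - (k - 1)) u = drop (length v - (k - 1)) v"
      using 1 unfolding windows_take[OF n(2)] windows_take[OF n(3)] by (simp add: mset_map)
    moreover have "2 * k - (k - 1) = k + 1" using k by simp
    ultimately show ?thesis using len by metis
  qed
  define x y where "x = take (k - 1) u" and "y = drop (k + 1) u"
  have split: "t = take (k - 1) t @ t ! (k - 1) # t ! k # drop (k + 1) t" if "length t = 2 * k" for t :: "'a list"
    using id_take_nth_drop[of "k - 1" t] Cons_nth_drop_Suc[of k t] k that by simp
  have u: "u = x @ u ! (k - 1) # u ! k # y" and v: "v = x @ v ! (k - 1) # v ! k # y"
    using split[OF len(1)] split[OF len(2)] ends unfolding x_def y_def by metis+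
  have "{#u ! (k - 1), u ! k#} = {#v ! (k - 1), v ! k#}"
    using ms by (subst (asm) u, subst (asm) v) simp
  moreover have "u ! (k - 1) \<noteq> v ! (k - 1) \<or> u ! k \<noteq> v ! k" using u v ne by metis
  ultimately have "v ! (k - 1) = u ! k" "v ! k = u ! (k - 1)" "u ! (k - 1) \<noteq> u ! k"
    by (auto simp: add_eq_conv_diff split: if_splits)
  moreover have "length x = k - 1" "length y = k - 1" using len by (auto simp: x_def y_def)
  ultimately show thesis using that[of "u ! (k - 1)" "u ! k" x y] u v by metis
qed

text \<open>The window of length \<open>k\<close> starting \<open>t\<close> letters before \<open>b\<close> in the word \<open>xaby\<close>.\<close>

definition window_at :: "nat \<Rightarrow> 'a list \<Rightarrow> 'a \<Rightarrow> 'a \<Rightarrow> 'a list \<Rightarrow> nat \<Rightarrow> 'a list" where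
  "window_at k x a b y t = (if t = 0 then b # y else take k (drop (k - t) x @ a # b # y))"

lemma take_window_at:
  "0 < t \<Longrightarrow> m \<le> k \<Longrightarrow> take m (window_at k x a b y t) = take m (drop (k - t) x @ a # b # y)"
  by (simp add: window_at_def min_absorb1 del: take_append)

lemma set_windows_eq:
  assumes "length x = k - 1" "length y = k - 1" "k > 0"
  shows "set (windows (x @ a # b # y) k) = window_at k x a b y ` {..k}"
proof -
  let ?u = "x @ a # b # y"
  have "take k (drop (k - t) ?u) = window_at k x a b y t" if "t \<le> k" for t
  proof (cases "t = 0")
    case True
    then have "drop (k - t) ?u = b # y" using assms by (cases k) simp_all
    then show ?thesis using True assms by (simp only: window_at_def) simp
  next
    case False
    then have "drop (k - t) ?u = drop (k - t) x @ a # b # y" using assms that by simp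
    then show ?thesis using False by (simp only: window_at_def if_False)
  qed
  then have "window_at k x a b y ` {..k} = (\<lambda>t. take k (drop (k - t) ?u)) ` {..k}"
    by (intro image_cong) simp_all
  also have "\<dots> = (\<lambda>i. take k (drop i ?u)) ` (\<lambda>t. k - t) ` {..k}" by (simp only: image_image)
  also have "(\<lambda>t. k - t) ` {..k} = {0..<Suc (length ?u) - k}"
  proof -
    have "i \<in> (\<lambda>t. k - t) ` {..k}" if "i \<le> k" for i
      using that by (intro image_eqI[of _ _ "k - i"]) simp_all
    then have "(\<lambda>t. k - t) ` {..k} = {..k}" by auto
    moreover have "Suc (length ?u) - k = Suc k" using assms by simp
    ultimately show ?thesis by (simp only: lessThan_atLeast0[symmetric] lessThan_Suc_atMost)
  qed
  finally show ?thesis by (simp only: windows_def set_map set_upt)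
qed

text \<open>
  If two families enumerate the same set and \<open>f\<close> strictly increases from \<open>U t\<close> to \<open>V t\<close> except for
  \<open>t = 0\<close>, then the steps \<open>U t \<rightarrow> V t\<close> lead from \<open>V 0\<close> to every member of the set.
\<close>

lemma chain_induct:
  fixes f :: "'c \<Rightarrow> nat" and U V :: "nat \<Rightarrow> 'c"
  assumes eq: "U ` {..k} = V ` {..k}"
    and incr: "\<And>t. 0 < t \<Longrightarrow> t \<le> k \<Longrightarrow> f (U t) < f (V t)"
    and Q0: "Q (V 0)" and Q: "\<And>t. 0 < t \<Longrightarrow> t \<le> k \<Longrightarrow> Q (U t) \<Longrightarrow> Q (V t)"
    and w: "w \<in> V ` {..k}"
  shows "Q w"
  using w
proof (induction w rule: measure_induct_rule[of f])
  case (less w)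
  then obtain t where t: "t \<le> k" "w = V t" by auto
  show ?case
  proof (cases "t = 0")
    case False
    have "U t \<in> V ` {..k}" using eq t(1) by blast
    moreover have "f (U t) < f w" using incr[of t] t False by simp
    ultimately have "Q (U t)" by (intro less.IH)
    then show ?thesis using Q[of t] t False by simp
  qed (use Q0 t in simp)
qed

section \<open>Letter counts along the chain of windows\<close>

text \<open>Each \<open>b\<close> contributes its position counted from the end, so moving a
  \<open>b\<close> to the left or turning a final \<open>a\<close> into \<open>b\<close> raises the
  weight.\<close>

fun weight :: "'a \<Rightarrow> 'a list \<Rightarrow> nat" where
  "weight b [] = 0"
| "weight b (c # w) = (if c = b then Suc (length w) else 0) + weight b w"

lemma weight_append_less: "length w = length w' \<Longrightarrow> weight b w < weight b w' \<Longrightarrow> weight b (s @ w) < weight b (s @ w')"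
  by (induction s) auto

text \<open>With \<open>s\<close> a suffix of \<open>x\<close>, this separates the window that ends
  with the first middle letter from those that contain both.\<close>

lemma take_prefix_split:
  assumes "length s < k"
  shows "(\<forall>c d. take k (s @ c # d # y) = s @ [c]) \<or> (\<exists>r. \<forall>c d. take k (s @ c # d # y) = s @ c # d # take r y)"
proof -
  obtain r where "k = Suc (length s + r)" using less_imp_Suc_add[OF assms] by auto
  then show ?thesis by (cases r) auto
qed

context
  fixes k :: nat and x y :: "'a list" and a b :: 'a
  assumes len: "length x = k - 1" "length y = k - 1" and k: "k > 0" and ab: "a \<noteq> b"
    and eq: "window_at k x a b y ` {..k} = window_at k x b a y ` {..k}"
begin

lemma weight_window_less:
  assumes "0 < t" "t \<le> k"
  shows "weight b (window_at k x a b y t) < weight b (window_at k x b a y t)"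
proof -
  define s where "s = drop (k - t) x"
  have "length s < k" using assms len k by (simp add: s_def)
  from take_prefix_split[OF this, of y]
  have "weight b (take k (s @ a # b # y)) < weight b (take k (s @ b # a # y))"
  proof (elim disjE exE)
    assume "\<forall>c d. take k (s @ c # d # y) = s @ [c]"
    then show ?thesis using ab by (auto intro!: weight_append_less)
  next
    fix r assume "\<forall>c d. take k (s @ c # d # y) = s @ c # d # take r y"
    then show ?thesis using ab by (auto intro!: weight_append_less)
  qed
  then show ?thesis using assms unfolding window_at_def s_def by simp
qed

text \<open>The chain starts at \<open>a # y\<close>, the window of \<open>xbay\<close> with
  \<open>t = 0\<close>, and reaches all windows of both words because their sets coincide.\<close>

lemma window_chain_induct:
  assumes "Q (a # y)"
    and "\<And>t. 0 < t \<Longrightarrow> t \<le> k \<Longrightarrow> Q (window_at k x a b y t) \<Longrightarrow> Q (window_at k x b a y t)"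
    and "t \<le> k"
  shows "Q (window_at k x a b y t)" "Q (window_at k x b a y t)"
proof -
  have "Q w" if "w \<in> window_at k x b a y ` {..k}" for w
    by (rule chain_induct[where f="weight b" and Q=Q, OF eq weight_window_less _ _ that])
      (use assms in \<open>auto simp: window_at_def\<close>)
  then show "Q (window_at k x a b y t)" "Q (window_at k x b a y t)"
    using eq assms(3) by (blast, blast)
qed

text \<open>A third letter at index \<open>j\<close> of \<open>y\<close> stands at
  \<open>Suc j\<close> in \<open>a # y\<close>. The steps of the chain alter only letters
  \<open>a\<close> and \<open>b\<close>, so it would stand there in every window; but the window
  with \<open>t = Suc j\<close> has \<open>b\<close> at that place.\<close>

lemma y_letters: "set y \<subseteq> {a, b}"
proof
  fix z assume "z \<in> set y"
  then obtain j where j: "j < k - 1" "y ! j = z" using len by (metis in_set_conv_nth)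
  show "z \<in> {a, b}"
  proof (rule ccontr)
    assume z: "z \<notin> {a, b}"
    have "window_at k x a b y (Suc j) ! Suc j = z"
    proof (rule window_chain_induct(1)[where Q="\<lambda>w. w ! Suc j = z"])
      show "(a # y) ! Suc j = z" using j by simp
      fix t assume t: "0 < t" "t \<le> k" and z': "window_at k x a b y t ! Suc j = z"
      have "length (drop (k - t) x) = t - 1" using len t by simp
      then show "window_at k x b a y t ! Suc j = z"
        using z' z t j len by (auto simp: window_at_def nth_append nth_Cons' split: if_splits)
    qed (use j in simp)
    moreover have "window_at k x a b y (Suc j) ! Suc j = b"
      using j len by (simp add: window_at_def nth_append)
    ultimately show False using z by simp
  qed
qed

text \<open>The property passes along the chain from \<open>a # y\<close> to the window with
  \<open>t = k\<close>, which is \<open>x\<close> followed by \<open>a\<close>.\<close>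

lemma x_letters: "set x \<subseteq> {a, b}"
proof -
  have "set (window_at k x a b y k) \<subseteq> {a, b}"
  proof (rule window_chain_induct(1)[where Q="\<lambda>w. set w \<subseteq> {a, b}"])
    show "set (a # y) \<subseteq> {a, b}" using y_letters by simp
    fix t assume t: "0 < t" "t \<le> k" and *: "set (window_at k x a b y t) \<subseteq> {a, b}"
    have "set (drop (k - t) x) \<subseteq> set (window_at k x a b y t)"
      using t len k by (auto simp: window_at_def)
    then show "set (window_at k x b a y t) \<subseteq> {a, b}"
      using * t y_letters by (auto simp: window_at_def dest!: in_set_takeD)
  qed simp
  then show ?thesis using k len by (auto simp: window_at_def)
qed

text \<open>No step of the chain lowers the number of \<open>b\<close> in a prefix, and the chain
  begins with \<open>a # y\<close>.\<close>

lemma prefix_count_ge: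
  assumes "m \<le> k" "t \<le> k"
  shows "count_list (take m (window_at k x a b y t)) b \<ge> count_list (take m (a # y)) b"
proof (rule window_chain_induct(1)[where Q="\<lambda>w. count_list (take m w) b \<ge> count_list (take m (a # y)) b"])
  fix t assume t: "0 < t" "t \<le> k"
    and *: "count_list (take m (a # y)) b \<le> count_list (take m (window_at k x a b y t)) b"
  define s where "s = drop (k - t) x"
  have "count_list (take r (a # b # y)) b \<le> count_list (take r (b # a # y)) b" for r
    using ab by (cases r; cases "r - 1") auto
  then have "count_list (take m (s @ a # b # y)) b \<le> count_list (take m (s @ b # a # y)) b" by simp
  then show "count_list (take m (a # y)) b \<le> count_list (take m (window_at k x b a y t)) b"
    using * t assms(1) unfolding s_def by (simp only: take_window_at)
qed (use assms in simp_all)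

end

lemma count_list_two_letters:
  "set l \<subseteq> {a, b} \<Longrightarrow> a \<noteq> b \<Longrightarrow> count_list l a + count_list l b = length l"
  by (induction l) auto

context
  fixes k :: nat and x y :: "'a list" and a b :: 'a
  assumes len: "length x = k - 1" "length y = k - 1" and k: "k > 0" and ab: "a \<noteq> b"
    and eq: "window_at k x a b y ` {..k} = window_at k x b a y ` {..k}"
begin

text \<open>The upper bound is the lower bound for the letter \<open>a\<close>, obtained by
  exchanging \<open>a\<close> with \<open>b\<close> and thereby the two words; the two counts add up
  to the length.\<close>

lemma window_count_bounds:
  assumes m: "0 < m" "m \<le> k" and w: "w \<in> window_at k x a b y ` {..k}"
  shows "count_list (take (m - 1) y) b \<le> count_list (take m w) b"
    and "count_list (take m w) b \<le> count_list (take (m - 1) y) b + 1"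
proof -
  have Cons: "take m (c # y) = c # take (m - 1) y" for c using m by (cases m) auto
  obtain t where t: "t \<le> k" "w = window_at k x a b y t" using w by auto
  then show "count_list (take (m - 1) y) b \<le> count_list (take m w) b"
    using prefix_count_ge[OF len k ab eq m(2), of t] ab unfolding Cons by simp
  have letters: "set x \<subseteq> {a, b}" "set y \<subseteq> {a, b}"
    using x_letters[OF len k ab eq] y_letters[OF len k ab eq] .
  have "set w \<subseteq> {a, b}" "length w = k"
    using letters len k t by (auto simp: window_at_def dest!: in_set_takeD in_set_dropD)
  then have "count_list (take m w) a + count_list (take m w) b = m"
    using count_list_two_letters[of "take m w" a b] ab m set_take_subset[of m w] by auto
  moreover have "count_list (take (m - 1) y) a + count_list (take (m - 1) y) b = m - 1"
    using count_list_two_letters[of "take (m - 1) y" a b] ab m len letters(2) set_take_subset[of "m - 1" y] by auto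
  moreover obtain t' where t': "t' \<le> k" "w = window_at k x b a y t'" using w eq by auto
  then have "count_list (take (m - 1) y) a \<le> count_list (take m w) a"
    using prefix_count_ge[OF len k ab[symmetric] eq[symmetric] m(2), of t'] ab unfolding Cons by simp
  ultimately show "count_list (take m w) b \<le> count_list (take (m - 1) y) b + 1" using m by linarith
qed

text \<open>At length \<open>t\<close>, the windows of the two words have prefixes consisting of the
  same suffix of \<open>x\<close> followed by \<open>a\<close> and by \<open>b\<close>. The lower
  bound for the first and the upper bound for the second meet.\<close>

lemma x_count:
  assumes t: "0 < t" "t \<le> k"
  shows "count_list (drop (k - t) x) b = count_list (take (t - 1) y) b"
proof -
  have "length (drop (k - t) x) = t - 1" using t len by simp
  then have take: "take t (drop (k - t) x @ c # z) = drop (k - t) x @ [c]" for c z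
    using t by simp
  have U: "window_at k x a b y t \<in> window_at k x a b y ` {..k}"
    and V: "window_at k x b a y t \<in> window_at k x a b y ` {..k}" using t eq by auto
  show ?thesis
    using window_count_bounds(1)[OF t U] window_count_bounds(2)[OF t V] ab
    unfolding take_window_at[OF t] take by simp
qed

text \<open>The prefix of length \<open>t + m\<close> of the window at \<open>t\<close> is a suffix
  of \<open>x\<close>, then \<open>ab\<close>, then a prefix of \<open>y\<close>. By
  \<open>x_count\<close> its number of \<open>b\<close> is the sum of the two counts plus 1, to
  which \<open>window_count_bounds\<close> applies.\<close>

lemma y_count_quasi_additive:
  assumes "0 < t" "0 < m" "t + m \<le> k"
  shows "count_list (take (t - 1) y) b + count_list (take (m - 1) y) b \<le> count_list (take (t + m - 1) y) b"
    and "count_list (take (t + m - 1) y) b \<le> count_list (take (t - 1) y) b + count_list (take (m - 1) y) b + 1"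
proof -
  have "length (drop (k - t) x) = t - 1" using assms len by simp
  moreover have "t + m - (t - 1) = Suc (Suc (m - 1))" using assms by simp
  ultimately have take: "take (t + m) (drop (k - t) x @ a # b # y) = drop (k - t) x @ a # b # take (m - 1) y"
    using assms(2) by (cases m) simp_all
  have U: "window_at k x a b y t \<in> window_at k x a b y ` {..k}" using assms by auto
  have tm: "0 < t + m" using assms by simp
  have tk: "t \<le> k" using assms by simp
  have "count_list (take (t + m) (window_at k x a b y t)) b =
      count_list (take (t - 1) y) b + 1 + count_list (take (m - 1) y) b"
    unfolding take_window_at[OF assms(1) assms(3)] take using x_count[OF assms(1) tk] ab by simp
  then show "count_list (take (t - 1) y) b + count_list (take (m - 1) y) b \<le> count_list (take (t + m - 1) y) b"
    "count_list (take (t + m - 1) y) b \<le> count_list (take (t - 1) y) b + count_list (take (m - 1) y) b + 1"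
    using window_count_bounds[OF tm assms(3) U] by auto
qed

end

section \<open>From quasi-additive counts to an irrational slope\<close>

text \<open>Subtractive Euclidean algorithm on \<open>i\<close> and \<open>j\<close>, ending at
  \<open>i = j\<close>. The inequality is \<open>g i / i < (g j + 1) / j\<close> without
  denominators.\<close>

lemma quasi_additive_cross:
  fixes g :: "nat \<Rightarrow> nat"
  assumes lower: "\<And>i j. 0 < i \<Longrightarrow> 0 < j \<Longrightarrow> i + j \<le> k \<Longrightarrow> g i + g j \<le> g (i + j)"
    and upper: "\<And>i j. 0 < i \<Longrightarrow> 0 < j \<Longrightarrow> i + j \<le> k \<Longrightarrow> g (i + j) \<le> g i + g j + 1"
    and "0 < i" "i \<le> k" "0 < j" "j \<le> k"
  shows "g i * j < (g j + 1) * i"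
  using assms(3-)
proof (induction "i + j" arbitrary: i j rule: less_induct)
  case less
  consider "i = j" | "i < j" | "j < i" by linarith
  then show ?case
  proof cases
    case 1 then show ?thesis using less.prems by simp
  next
    case 2
    then obtain d where d: "j = i + d" "0 < d" using less_imp_add_positive by blast
    have "g i * d < (g d + 1) * i" using less.hyps[of i d] less.prems d by simp
    moreover have "(g i + g d) * i \<le> g j * i" using lower[of i d] less.prems d by simp
    ultimately show ?thesis unfolding d by (simp add: algebra_simps)
  next
    case 3
    then obtain d where d: "i = j + d" "0 < d" using less_imp_add_positive by blast
    have "g d * j < (g j + 1) * d" using less.hyps[of d j] less.prems d by simp
    moreover have "g i \<le> g j + g d + 1" using upper[of j d] less.prems d by simp
    then have "g i * j \<le> (g j + g d + 1) * j" by (rule mult_le_mono1)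
    ultimately show ?thesis unfolding d by (simp add: algebra_simps)
  qed
qed

text \<open>The conditions on \<alpha> define an open interval, non-empty by
  \<open>quasi_additive_cross\<close>; being uncountable, it contains an irrational number.\<close>

lemma quasi_additive_slope:
  fixes g :: "nat \<Rightarrow> nat"
  assumes lower: "\<And>i j. 0 < i \<Longrightarrow> 0 < j \<Longrightarrow> i + j \<le> k \<Longrightarrow> g i + g j \<le> g (i + j)"
    and upper: "\<And>i j. 0 < i \<Longrightarrow> 0 < j \<Longrightarrow> i + j \<le> k \<Longrightarrow> g (i + j) \<le> g i + g j + 1"
    and "0 < k"
  obtains \<alpha> :: real where "\<alpha> \<notin> \<rat>"
    "\<And>i. 0 < i \<Longrightarrow> i \<le> k \<Longrightarrow> real (g i) < real i * \<alpha> \<and> real i * \<alpha> < real (g i) + 1"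
proof -
  define lo hi where "lo = Max ((\<lambda>i. real (g i) / real i) ` {1..k})"
    and "hi = Min ((\<lambda>i. (real (g i) + 1) / real i) ` {1..k})"
  have ne: "{1..k} \<noteq> {}" using \<open>0 < k\<close> by simp
  have "lo \<in> (\<lambda>i. real (g i) / real i) ` {1..k}" unfolding lo_def using ne by (intro Max_in) auto
  then obtain i where i: "i \<in> {1..k}" "lo = real (g i) / real i" by blast
  have "hi \<in> (\<lambda>i. (real (g i) + 1) / real i) ` {1..k}" unfolding hi_def using ne by (intro Min_in) auto
  then obtain j where j: "j \<in> {1..k}" "hi = (real (g j) + 1) / real j" by blast
  have "g i * j < (g j + 1) * i"
    by (rule quasi_additive_cross[of k]) (use lower upper i j in auto)
  then have "real (g i * j) < real ((g j + 1) * i)" by (simp only: of_nat_less_iff)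
  then have "real (g i) / real i < (real (g j) + 1) / real j" using i(1) j(1) by (simp add: field_simps)
  then have "lo < hi" unfolding i(2) j(2) .
  then have "uncountable {lo<..<hi}" by (simp add: uncountable_open_interval)
  then have "\<not> {lo<..<hi} \<subseteq> \<rat>" using countable_subset[OF _ countable_rat] by auto
  then obtain \<alpha> where \<alpha>: "\<alpha> \<in> {lo<..<hi}" "\<alpha> \<notin> \<rat>" by blast
  have "real (g i) < real i * \<alpha> \<and> real i * \<alpha> < real (g i) + 1" if "0 < i" "i \<le> k" for i
  proof -
    have "real (g i) / real i \<le> lo" unfolding lo_def using that by (intro Max_ge) auto
    moreover have "hi \<le> (real (g i) + 1) / real i" unfolding hi_def using that by (intro Min_le) auto
    ultimately have "real (g i) / real i < \<alpha>" "\<alpha> < (real (g i) + 1) / real i" using \<alpha>(1) by auto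
    then show ?thesis using that by (simp add: field_simps)
  qed
  then show thesis using \<alpha>(2) that by blast
qed

section \<open>Both directions of the equivalence\<close>

lemma k_abelian_equiv_imp_sturmian:
  assumes eq: "k_abelian_equiv k u v" and k: "k > 0" and len: "length u = 2 * k" "length v = 2 * k"
    and ne: "u \<noteq> v"
  obtains a b x and w :: "'a word" where "a \<noteq> b" "sturmian {a, b} w" "right_special w x" "length x = k - 1"
    "u = x @ [a, b] @ rev x" "v = x @ [b, a] @ rev x"
proof -
  obtain a b x y where ab: "a \<noteq> b" and xy: "length x = k - 1" "length y = k - 1"
    and u: "u = x @ a # b # y" and v: "v = x @ b # a # y"
    using k_abelian_equiv_shape[OF eq k len ne] .
  have wins: "window_at k x a b y ` {..k} = window_at k x b a y ` {..k}"
    using arg_cong[OF k_abelian_equiv_windows[OF eq k order_refl], of set_mset]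
    unfolding set_mset_mset u v set_windows_eq[OF xy k] .
  \<comment> \<open>The shift makes \<open>g i\<close> the number of \<open>b\<close> in the prefix
    of length \<open>i\<close> of \<open>a # y\<close>; in particular \<open>g 1 = 0\<close>, which
    places the slope strictly between 0 and 1.\<close>
  define g where "g i = count_list (take (i - 1) y) b" for i
  obtain \<alpha> :: real where \<alpha>: "\<alpha> \<notin> \<rat>"
    and g: "\<And>i. 0 < i \<Longrightarrow> i \<le> k \<Longrightarrow> real (g i) < real i * \<alpha> \<and> real i * \<alpha> < real (g i) + 1"
    using quasi_additive_slope[of k g] y_count_quasi_additive[OF xy k ab wins] k unfolding g_def by blast
  have "0 < \<alpha>" "\<alpha> < 1" using g[of 1] k by (simp_all add: g_def)
  then interpret irrational_slope \<alpha> using \<alpha> by unfold_locales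
  have flr: "flr (int i + 1) = int (g (Suc i))" if "Suc i \<le> k" for i
    using g[of "Suc i"] that unfolding flr_def by (intro floor_unique) (auto simp: add.commute)
  have y: "y = slope_prefix a b (k - 1)"
  proof -
    have "y = slope_prefix a b (length y)"
    proof (rule slope_prefix_unique[OF y_letters[OF xy k ab wins] ab])
      show "int (count_list (take i y) b) = flr (int i + 1)" if "i \<le> length y" for i
        using flr[of i] that xy k by (simp add: g_def)
    qed
    then show ?thesis unfolding xy .
  qed
  \<comment> \<open>By \<open>x_count\<close>, the prefix counts of \<open>rev x\<close> are those
    of \<open>y\<close>, hence the same floors.\<close>
  have "rev x = slope_prefix a b (length (rev x))"
  proof (rule slope_prefix_unique[OF _ ab])
    show "set (rev x) \<subseteq> {a, b}" using x_letters[OF xy k ab wins] by simp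
    show "int (count_list (take i (rev x)) b) = flr (int i + 1)" if "i \<le> length (rev x)" for i
    proof -
      have i: "Suc i \<le> k" "length x - i = k - Suc i" using that xy k by auto
      have "count_list (take i (rev x)) b = count_list (drop (k - Suc i) x) b"
        unfolding take_rev count_list_rev i(2) ..
      then show ?thesis using x_count[OF xy k ab wins _ i(1)] flr[OF i(1)] by (simp add: g_def)
    qed
  qed
  then have x: "rev x = slope_prefix a b (k - 1)" using xy by simp
  have xy': "y = rev x" using x y by simp
  let ?w = "mechanical a b"
  have u': "u = x @ [a, b] @ rev x" and v': "v = x @ [b, a] @ rev x" using u v xy' by simp_all
  have fac: "u \<in> factors ?w" "v \<in> factors ?w"
    using central_in_factors[OF mechanical_slope_coding[OF ab] mechanical_letters ab, of "k - 1"]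
    unfolding x[symmetric] rev_rev_ident u' v' by auto
  have pre: "take n t \<in> factors ?w" if t: "t \<in> factors ?w" for n t
  proof (cases "n \<le> length t")
    case True
    obtain p where "t = block ?w p (length t)" using t unfolding factors_iff_block by blast
    then have "take n t = block ?w p n" using take_drop_block[of 0 n "length t" ?w p] True by simp
    then show ?thesis using block_in_factors by metis
  qed (use t in simp)
  have "x @ [a] \<in> factors ?w" "x @ [b] \<in> factors ?w" "x \<in> factors ?w"
    using pre[OF fac(1), of "Suc (length x)"] pre[OF fac(2), of "Suc (length x)"]
      pre[OF fac(1), of "length x"] unfolding u' v' by simp_all
  then have "right_special ?w x" unfolding right_special_def using ab by blast
  then show thesis using that ab mechanical_sturmian[OF ab] xy u' v' by blast
qed

text \<open>Once \<open>x\<close> is known to be a reversed \<open>slope_prefix\<close>, the two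
  words are the central words for \<open>ceil\<close> and \<open>flr\<close> of the slope of
  \<open>w\<close>.\<close>

lemma right_special_central:
  assumes st: "sturmian {a, b} w" and rs: "right_special w x"
  shows "k_abelian_equiv (Suc (length x)) (x @ [a, b] @ rev x) (x @ [b, a] @ rev x)"
    and "x @ [a, b] @ rev x \<in> factors w" and "x @ [b, a] @ rev x \<in> factors w"
proof -
  note ab = sturmian_two_letters[OF st]
  obtain \<alpha> \<rho> where \<alpha>: "\<alpha> \<notin> \<rat>" "0 < \<alpha>" "\<alpha> < 1" and sl: "slope_coding \<alpha> \<rho> b w"
    using sturmian_slope_coding[OF st] .
  interpret irrational_slope \<alpha> using \<alpha> by unfold_locales
  have x: "x = rev (slope_prefix a b (length x))"
    using right_special_eq[OF sl ab(2) ab(1) rs] .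
  then have x': "rev x = slope_prefix a b (length x)" by (metis rev_rev_ident)
  show "k_abelian_equiv (Suc (length x)) (x @ [a, b] @ rev x) (x @ [b, a] @ rev x)"
    using central_k_abelian[OF st sl, of "length x"] unfolding x'[symmetric] rev_rev_ident .
  show "x @ [b, a] @ rev x \<in> factors w" "x @ [a, b] @ rev x \<in> factors w"
    using central_in_factors[OF sl ab(2) ab(1), of "length x"] unfolding x'[symmetric] rev_rev_ident .
qed

theorem theorem6:
  fixes k :: nat and u v :: "'a list"
  assumes "k > 0" and "length u = 2 * k" and "length v = 2 * k" and "u \<noteq> v"
  shows "(k_abelian_equiv k u v \<longleftrightarrow>
           (\<exists>a b. \<exists>\<omega> :: 'a word. \<exists>x. a \<noteq> b \<and> sturmian {a, b} \<omega> \<and>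
              right_special \<omega> x \<and> length x = k - 1 \<and>
              u = x @ [a, b] @ rev x \<and> v = x @ [b, a] @ rev x)) \<and>
         (\<forall>a b. \<forall>\<omega> :: 'a word. \<forall>x. a \<noteq> b \<and> sturmian {a, b} \<omega> \<and>
              right_special \<omega> x \<and> length x = k - 1 \<and>
              u = x @ [a, b] @ rev x \<and> v = x @ [b, a] @ rev x \<longrightarrow>
              u \<in> factors \<omega> \<and> v \<in> factors \<omega>)"
proof (intro conjI iffI allI impI)
  assume "k_abelian_equiv k u v"
  then show "\<exists>a b. \<exists>\<omega> :: 'a word. \<exists>x. a \<noteq> b \<and> sturmian {a, b} \<omega> \<and>
      right_special \<omega> x \<and> length x = k - 1 \<and> u = x @ [a, b] @ rev x \<and> v = x @ [b, a] @ rev x"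
    by (rule k_abelian_equiv_imp_sturmian[OF _ assms]) blast
next
  assume "\<exists>a b. \<exists>\<omega> :: 'a word. \<exists>x. a \<noteq> b \<and> sturmian {a, b} \<omega> \<and>
      right_special \<omega> x \<and> length x = k - 1 \<and> u = x @ [a, b] @ rev x \<and> v = x @ [b, a] @ rev x"
  then obtain a b x and w :: "'a word" where st: "sturmian {a, b} w" and rs: "right_special w x"
    and "length x = k - 1" and uv: "u = x @ [a, b] @ rev x" "v = x @ [b, a] @ rev x"
    by blast
  then have "Suc (length x) = k" using assms(1) by simp
  then show "k_abelian_equiv k u v"
    using right_special_central(1)[OF st rs] unfolding uv by metis
next
  fix a b x and w :: "'a word"
  assume *: "a \<noteq> b \<and> sturmian {a, b} w \<and> right_special w x \<and> length x = k - 1 \<and>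
    u = x @ [a, b] @ rev x \<and> v = x @ [b, a] @ rev x"
  then show "u \<in> factors w" "v \<in> factors w"
    using right_special_central(2,3)[of a b w x] by simp_all
qed

end
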